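(* Let $H$ be a free abelian group with finite basis $\mathcal{B}=\{\alpha_1,\dots,\alpha_d\}$, let $n\ge 1$, and let $\omega=(n_1,\dots,n_d)$ be a sequence of non-negative integers with $\sum_i n_i=n+2$. Let $\delta(\omega)$ be the greatest common divisor of $n_1,\dots,n_d$. Then $$\delta(\omega)\cdot\ker\left(\eta'_n|_{\mathcal{A}^t_\omega(H)}\right)=0.$$
   Context: $\mathcal{A}^t_n(H)$ is the quotient of the free abelian group generated by unitrivalent trees with $n$ trivalent vertices (hence $n+2$ univalent vertices), each trivalent vertex equipped with an orientation (a cyclic ordering of its three incident edges) and each univalent vertex labeled by an element of $H$, by the following relations. (i) Anti-symmetry: $T+T'=0$ if $T'$ is identical with $T$ except that one trivalent vertex has the opposite orientation. (ii) IHX: for rooted labeled oriented trees $A,B,C,D$ let $W(A,B,C,D)$ be the tree with two adjacent trivalent vertices $u,v$ joined by an edge $e$, with $A,B$ attached at $u$ in cyclic order $(A,B,e)$ and $C,D$ attached at $v$ in cyclic order $(e,C,D)$; then $W(A,B,C,D)+W(B,C,A,D)+W(C,A,B,D)=0$. (iii) Linearity: $T=T_1+T_2$ if $T_1,T_2,T$ are identical except that one univalent vertex has labels $a_1,a_2,a_1+a_2\in H$ respectively. Equivalently, $\mathcal{A}^t_n(H)$ is generated by such trees with all labels in the basis $\mathcal{B}$, subject only to anti-symmetry and IHX. A tree with labels in $\mathcal{B}$ has signature $\omega=(n_1,\dots,n_d)$ if exactly $n_i$ of its univalent vertices are labeled by $\alpha_i$, for each $i$. $\mathcal{A}^t_\omega(H)$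 is the abelian group generated by the trees (with labels in $\mathcal{B}$) of signature $\omega$, subject to the anti-symmetry and IHX relations; since these relations preserve signature, $\mathcal{A}^t_n(H)=\bigoplus_\omega\mathcal{A}^t_\omega(H)$, the sum over all $\omega$ with $\sum_i n_i=n+2$, and $\mathcal{A}^t_\omega(H)$ is regarded as a subgroup of $\mathcal{A}^t_n(H)$. A quasi-Lie algebra (over $\mathbb{Z}$) is an abelian group with a bilinear bracket satisfying $[\alpha,\beta]+[\beta,\alpha]=0$ and the Jacobi identity $[[\alpha,\beta],\gamma]+[[\beta,\gamma],\alpha]+[[\gamma,\alpha],\beta]=0$ (the relation $[\alpha,\alpha]=0$ is not required). $\mathsf{L}'(H)=\bigoplus_n\mathsf{L}'_n(H)$ is the free quasi-Lie algebra on $H$, graded with $H$ in degree $1$. A unitrivalent tree, each of whose trivalent vertices is equipped with an orientation (a cyclic ordering of its three incident edges), with one univalent vertex unlabeled and designated as the root, and with the other $m$ univalent vertices labeled by elements of $H$, determines an element of $\mathsf{L}'_m(H)$ by iterated bracketing: a trivalent vertex with cyclic order (edge towards the root, first branch, second branch) gives the bracket [first, second]. The homomorphism $\eta'_n:\mathcal{A}^t_n(H)\to H\otimes\mathsf{L}'_{n+1}(H)$ is $\eta'_n(T)=\sum_i h_i\otimes[T_i]$, the sum over all univalent vertices of $T$, where $h_i$ is the label of the $i$-th one and $[T_i]\in\mathsf{L}'_{n+1}(H)$ is the element determined by the rooted tree $T_i$ obtained from $T$ by making that vertex the (unlabeled) root. *)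

theory Defs
  imports "HOL-Algebra.Free_Abelian_Groups" "HOL-Library.Multiset"
begin

section \<open>Abelian groups given by generators and relations\<close>

text \<open>
  All groups are written multiplicatively, as usual in HOL-Algebra. The exception is
  \<^const>\<open>free_Abelian_group\<close>, whose operation is the addition of finitely supported
  functions with integer values.
\<close>

definition presented_group :: "'s set \<Rightarrow> ('s \<Rightarrow>\<^sub>0 int) set \<Rightarrow> ('s \<Rightarrow>\<^sub>0 int) set monoid"
  where "presented_group S R =
    free_Abelian_group S Mod generate (free_Abelian_group S) R"

definition presented_class :: "'s set \<Rightarrow> ('s \<Rightarrow>\<^sub>0 int) set \<Rightarrow> 's \<Rightarrow> ('s \<Rightarrow>\<^sub>0 int) set"
  where "presented_class S R s =
    generate (free_Abelian_group S) R #>\<^bsub>free_Abelian_group S\<^esub> frag_of s"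

definition free_map :: "('a, 'm) monoid_scheme \<Rightarrow> ('s \<Rightarrow> 'a) \<Rightarrow> ('s \<Rightarrow>\<^sub>0 int) \<Rightarrow> 'a"
  where "free_map G f x =
    (\<Otimes>\<^bsub>G\<^esub>s\<in>Poly_Mapping.keys x. f s [^]\<^bsub>G\<^esub> Poly_Mapping.lookup x s)"

text \<open>
  The homomorphism on a presented group that is given by \<open>f\<close> on the generators. It is
  meaningful when \<open>free_map G f\<close> is trivial on the relations (\<open>presented_map_hom\<close>,
  \<open>presented_map_class\<close>). For its two uses this is checked below: \<open>sig_inclusion_hom\<close>,
  \<open>sig_inclusion_class\<close>, \<open>eta_hom\<close>, \<open>eta_class\<close>.
\<close>

definition presented_map ::
    "('a, 'm) monoid_scheme \<Rightarrow> ('s \<Rightarrow> 'a) \<Rightarrow> ('s \<Rightarrow>\<^sub>0 int) set \<Rightarrow> 'a"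
  where "presented_map G f X = the_elem (free_map G f ` X)"

definition tensor_rels ::
    "('a, 'm) monoid_scheme \<Rightarrow> ('b, 'k) monoid_scheme \<Rightarrow> ('a \<times> 'b \<Rightarrow>\<^sub>0 int) set"
  where "tensor_rels G K =
    {frag_of (g \<otimes>\<^bsub>G\<^esub> g', k) - frag_of (g, k) - frag_of (g', k) | g g' k.
       g \<in> carrier G \<and> g' \<in> carrier G \<and> k \<in> carrier K} \<union>
    {frag_of (g, k \<otimes>\<^bsub>K\<^esub> k') - frag_of (g, k) - frag_of (g, k') | g k k'.
       g \<in> carrier G \<and> k \<in> carrier K \<and> k' \<in> carrier K}"

definition tensor_group ::
    "('a, 'm) monoid_scheme \<Rightarrow> ('b, 'k) monoid_scheme \<Rightarrow> ('a \<times> 'b \<Rightarrow>\<^sub>0 int) set monoid"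
  where "tensor_group G K = presented_group (carrier G \<times> carrier K) (tensor_rels G K)"

definition pure_tensor ::
    "('a, 'm) monoid_scheme \<Rightarrow> ('b, 'k) monoid_scheme \<Rightarrow> 'a \<Rightarrow> 'b \<Rightarrow> ('a \<times> 'b \<Rightarrow>\<^sub>0 int) set"
  where "pure_tensor G K g k =
    presented_class (carrier G \<times> carrier K) (tensor_rels G K) (g, k)"

definition free_basis :: "('h, 'm) monoid_scheme \<Rightarrow> (nat \<Rightarrow> 'h) \<Rightarrow> nat \<Rightarrow> bool"
  where "free_basis H \<alpha> d \<longleftrightarrow>
    \<alpha> ` {1..d} \<subseteq> carrier H \<and>
    (\<forall>h\<in>carrier H. \<exists>!c::nat \<Rightarrow> int. c \<in> {1..d} \<rightarrow>\<^sub>E UNIV \<and>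
       h = (\<Otimes>\<^bsub>H\<^esub>i\<in>{1..d}. \<alpha> i [^]\<^bsub>H\<^esub> c i))"


section \<open>Oriented labeled unitrivalent trees\<close>

text \<open>
  A rooted tree is drawn with its root edge dangling. In \<open>Node s t\<close> the root edge ends in a
  trivalent vertex whose cyclic order is (root edge, \<open>s\<close>, \<open>t\<close>); thus an orientation of all
  trivalent vertices is the same as a linear order of the two branches at every node.
\<close>

datatype 'h rtree = Leaf 'h | Node "'h rtree" "'h rtree"

primrec rtree_labels :: "'h rtree \<Rightarrow> 'h multiset" where
  "rtree_labels (Leaf h) = {#h#}"
| "rtree_labels (Node s t) = rtree_labels s + rtree_labels t"

primrec rtree_nodes :: "'h rtree \<Rightarrow> nat" where
  "rtree_nodes (Leaf h) = 0"
| "rtree_nodes (Node s t) = Suc (rtree_nodes s + rtree_nodes t)"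

text \<open>
  Gluing the root edges of \<open>s\<close> and \<open>t\<close> to a single edge yields an unrooted tree together with
  a distinguished edge; every such tree arises from a pair \<open>(s, t)\<close>, unique up to exchanging
  its components. Two pairs give the same unrooted tree iff they are related by moving the
  distinguished edge: across a trivalent vertex with cyclic order (edge to \<open>a\<close>, edge to \<open>b\<close>,
  edge to \<open>c\<close>), the pair \<open>(Node a b, c)\<close> becomes \<open>(a, Node b c)\<close>. An isomorphism class of
  unrooted oriented labeled trees is therefore an equivalence class of pairs.
\<close>

inductive move_edge :: "'h rtree \<times> 'h rtree \<Rightarrow> 'h rtree \<times> 'h rtree \<Rightarrow> bool" where
  swap: "move_edge (s, t) (t, s)"
| across: "move_edge (Node a b, c) (a, Node b c)"

quotient_type 'h utree = "'h rtree \<times> 'h rtree" / "equivclp move_edge"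
  by (rule equivp_evquivclp)

lift_definition glue :: "'h rtree \<Rightarrow> 'h rtree \<Rightarrow> 'h utree" is "\<lambda>s t. (s, t)" .

lemma equivclp_invariant:
  assumes "equivclp r x y" and "\<And>x y. r x y \<Longrightarrow> f x = f y"
  shows "f x = f y"
  using assms(1) by (induction rule: equivclp_induct) (auto dest: assms(2))

lemma glue_commute: "glue s t = glue t s"
  by transfer (simp add: r_into_equivclp move_edge.swap)

lemma glue_across: "glue (Node a b) c = glue a (Node b c)"
  by transfer (simp add: r_into_equivclp move_edge.across)

lift_definition labels :: "'h utree \<Rightarrow> 'h multiset"
  is "\<lambda>(s, t). rtree_labels s + rtree_labels t"
  by (erule equivclp_invariant) (auto elim!: move_edge.cases)

lift_definition trivalent :: "'h utree \<Rightarrow> nat"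
  is "\<lambda>(s, t). rtree_nodes s + rtree_nodes t"
  by (erule equivclp_invariant) (auto elim!: move_edge.cases)

text \<open>
  \<open>rootings_in s t\<close> lists, for the univalent vertices of \<open>glue s t\<close> that belong to \<open>s\<close>, the
  label together with the tree rooted at that vertex; \<open>rootings T\<close> does so for all univalent
  vertices of \<open>T\<close>, one entry for each vertex.
\<close>

primrec rootings_in :: "'h rtree \<Rightarrow> 'h rtree \<Rightarrow> ('h \<times> 'h rtree) multiset" where
  "rootings_in (Leaf h) t = {#(h, t)#}"
| "rootings_in (Node a b) t = rootings_in a (Node b t) + rootings_in b (Node t a)"

lift_definition rootings :: "'h utree \<Rightarrow> ('h \<times> 'h rtree) multiset"
  is "\<lambda>(s, t). rootings_in s t + rootings_in t s"
  by (erule equivclp_invariant) (auto elim!: move_edge.cases)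

lemma labels_glue: "labels (glue s t) = rtree_labels s + rtree_labels t"
  by transfer simp

lemma trivalent_glue: "trivalent (glue s t) = rtree_nodes s + rtree_nodes t"
  by transfer simp

lemma rootings_glue: "rootings (glue s t) = rootings_in s t + rootings_in t s"
  by transfer simp

lemma utree_cases: obtains s t where "T = glue s t"
  by transfer (auto intro: equivp_reflp[OF equivp_evquivclp])


section \<open>The tree groups\<close>

text \<open>
  Any trivalent vertex, univalent vertex or internal edge can be moved next to the
  distinguished edge, so the relations below apply at every place of a tree.
\<close>

definition as_rels :: "'h utree set \<Rightarrow> ('h utree \<Rightarrow>\<^sub>0 int) set"
  where "as_rels S =
    {frag_of (glue (Node a b) c) + frag_of (glue (Node b a) c) | a b c.
       glue (Node a b) c \<in> S}"

definition ihx_tree :: "'h rtree \<Rightarrow> 'h rtree \<Rightarrow> 'h rtree \<Rightarrow> 'h rtree \<Rightarrow> 'h utree"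
  where "ihx_tree A B C D = glue (Node A B) (Node C D)"

definition ihx_rels :: "'h utree set \<Rightarrow> ('h utree \<Rightarrow>\<^sub>0 int) set"
  where "ihx_rels S =
    {frag_of (ihx_tree A B C D) + frag_of (ihx_tree B C A D) + frag_of (ihx_tree C A B D)
       | A B C D. ihx_tree A B C D \<in> S}"

definition linear_rels ::
    "('h, 'm) monoid_scheme \<Rightarrow> 'h utree set \<Rightarrow> ('h utree \<Rightarrow>\<^sub>0 int) set"
  where "linear_rels H S =
    {frag_of (glue (Leaf (h \<otimes>\<^bsub>H\<^esub> k)) t) - frag_of (glue (Leaf h) t) - frag_of (glue (Leaf k) t)
       | h k t. h \<in> carrier H \<and> k \<in> carrier H \<and> glue (Leaf (h \<otimes>\<^bsub>H\<^esub> k)) t \<in> S}"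

definition trees :: "('h, 'm) monoid_scheme \<Rightarrow> nat \<Rightarrow> 'h utree set"
  where "trees H n = {T. set_mset (labels T) \<subseteq> carrier H \<and> trivalent T = n}"

definition tree_rels :: "('h, 'm) monoid_scheme \<Rightarrow> nat \<Rightarrow> ('h utree \<Rightarrow>\<^sub>0 int) set"
  where "tree_rels H n =
    as_rels (trees H n) \<union> ihx_rels (trees H n) \<union> linear_rels H (trees H n)"

definition tree_group :: "('h, 'm) monoid_scheme \<Rightarrow> nat \<Rightarrow> ('h utree \<Rightarrow>\<^sub>0 int) set monoid"
  where "tree_group H n = presented_group (trees H n) (tree_rels H n)"

definition sig_trees :: "(nat \<Rightarrow> 'h) \<Rightarrow> nat \<Rightarrow> (nat \<Rightarrow> nat) \<Rightarrow> 'h utree set"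
  where "sig_trees \<alpha> d \<omega> =
    {T. set_mset (labels T) \<subseteq> \<alpha> ` {1..d} \<and> (\<forall>i\<in>{1..d}. count (labels T) (\<alpha> i) = \<omega> i)}"

definition sig_rels :: "(nat \<Rightarrow> 'h) \<Rightarrow> nat \<Rightarrow> (nat \<Rightarrow> nat) \<Rightarrow> ('h utree \<Rightarrow>\<^sub>0 int) set"
  where "sig_rels \<alpha> d \<omega> = as_rels (sig_trees \<alpha> d \<omega>) \<union> ihx_rels (sig_trees \<alpha> d \<omega>)"

definition sig_tree_group ::
    "(nat \<Rightarrow> 'h) \<Rightarrow> nat \<Rightarrow> (nat \<Rightarrow> nat) \<Rightarrow> ('h utree \<Rightarrow>\<^sub>0 int) set monoid"
  where "sig_tree_group \<alpha> d \<omega> = presented_group (sig_trees \<alpha> d \<omega>) (sig_rels \<alpha> d \<omega>)"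

text \<open>
  The inclusion of \<open>sig_tree_group \<alpha> d \<omega>\<close> into \<open>tree_group H n\<close>, where the entries of \<open>\<omega>\<close>
  add up to \<open>n + 2\<close>, sends the class of a tree to the class of the same tree.
\<close>

definition sig_inclusion ::
    "('h, 'm) monoid_scheme \<Rightarrow> nat \<Rightarrow> ('h utree \<Rightarrow>\<^sub>0 int) set \<Rightarrow> ('h utree \<Rightarrow>\<^sub>0 int) set"
  where "sig_inclusion H n =
    presented_map (tree_group H n) (presented_class (trees H n) (tree_rels H n))"


section \<open>The free quasi-Lie algebra\<close>

text \<open>
  The free abelian group on the rooted trees with labels in \<open>H\<close>, with the bilinear extension
  of \<^const>\<open>Node\<close>, is the free nonassociative ring on the set \<open>H\<close>. The free quasi-Lie algebra
  on the abelian group \<open>H\<close> is its quotient by the two-sided ideal generated by additivity of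
  \<open>H\<close>, antisymmetry and the Jacobi identity.
\<close>

definition rtrees :: "('h, 'm) monoid_scheme \<Rightarrow> 'h rtree set"
  where "rtrees H = {t. set_mset (rtree_labels t) \<subseteq> carrier H}"

definition rtrees_of_degree :: "('h, 'm) monoid_scheme \<Rightarrow> nat \<Rightarrow> 'h rtree set"
  where "rtrees_of_degree H m = {t \<in> rtrees H. size (rtree_labels t) = m}"

definition frag_bracket ::
    "('h rtree \<Rightarrow>\<^sub>0 int) \<Rightarrow> ('h rtree \<Rightarrow>\<^sub>0 int) \<Rightarrow> ('h rtree \<Rightarrow>\<^sub>0 int)"
  where "frag_bracket x y =
    frag_extend (\<lambda>s. frag_extend (\<lambda>t. frag_of (Node s t)) y) x"

inductive_set qlie_ideal :: "('h, 'm) monoid_scheme \<Rightarrow> ('h rtree \<Rightarrow>\<^sub>0 int) set"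
  for H :: "('h, 'm) monoid_scheme"
where
  linear: "\<lbrakk>h \<in> carrier H; k \<in> carrier H\<rbrakk> \<Longrightarrow>
    frag_of (Leaf (h \<otimes>\<^bsub>H\<^esub> k)) - frag_of (Leaf h) - frag_of (Leaf k) \<in> qlie_ideal H"
| antisym: "\<lbrakk>x \<in> carrier (free_Abelian_group (rtrees H));
     y \<in> carrier (free_Abelian_group (rtrees H))\<rbrakk> \<Longrightarrow>
    frag_bracket x y + frag_bracket y x \<in> qlie_ideal H"
| jacobi: "\<lbrakk>x \<in> carrier (free_Abelian_group (rtrees H));
     y \<in> carrier (free_Abelian_group (rtrees H));
     z \<in> carrier (free_Abelian_group (rtrees H))\<rbrakk> \<Longrightarrow>
    frag_bracket (frag_bracket x y) z + frag_bracket (frag_bracket y z) x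
      + frag_bracket (frag_bracket z x) y \<in> qlie_ideal H"
| zero: "0 \<in> qlie_ideal H"
| diff: "\<lbrakk>x \<in> qlie_ideal H; y \<in> qlie_ideal H\<rbrakk> \<Longrightarrow> x - y \<in> qlie_ideal H"
| left: "\<lbrakk>x \<in> carrier (free_Abelian_group (rtrees H)); y \<in> qlie_ideal H\<rbrakk> \<Longrightarrow>
    frag_bracket x y \<in> qlie_ideal H"
| right: "\<lbrakk>x \<in> qlie_ideal H; y \<in> carrier (free_Abelian_group (rtrees H))\<rbrakk> \<Longrightarrow>
    frag_bracket x y \<in> qlie_ideal H"

definition qlie_class ::
    "('h, 'm) monoid_scheme \<Rightarrow> ('h rtree \<Rightarrow>\<^sub>0 int) \<Rightarrow> ('h rtree \<Rightarrow>\<^sub>0 int) set"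
  where "qlie_class H x = qlie_ideal H #>\<^bsub>free_Abelian_group (rtrees H)\<^esub> x"

definition free_qlie :: "('h, 'm) monoid_scheme \<Rightarrow> ('h rtree \<Rightarrow>\<^sub>0 int) set monoid"
  where "free_qlie H = free_Abelian_group (rtrees H) Mod qlie_ideal H"

definition qlie_bracket ::
    "('h, 'm) monoid_scheme \<Rightarrow> ('h rtree \<Rightarrow>\<^sub>0 int) set \<Rightarrow> ('h rtree \<Rightarrow>\<^sub>0 int) set
       \<Rightarrow> ('h rtree \<Rightarrow>\<^sub>0 int) set"
  where "qlie_bracket H X Y = (\<Union>x\<in>X. \<Union>y\<in>Y. qlie_class H (frag_bracket x y))"

primrec tree_bracket :: "('h, 'm) monoid_scheme \<Rightarrow> 'h rtree \<Rightarrow> ('h rtree \<Rightarrow>\<^sub>0 int) set" where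
  "tree_bracket H (Leaf h) = qlie_class H (frag_of (Leaf h))"
| "tree_bracket H (Node s t) = qlie_bracket H (tree_bracket H s) (tree_bracket H t)"

text \<open>The degree \<open>m\<close> part is spanned by the \<open>m\<close>-fold iterated brackets of elements of \<open>H\<close>.\<close>

definition free_qlie_degree ::
    "('h, 'm) monoid_scheme \<Rightarrow> nat \<Rightarrow> ('h rtree \<Rightarrow>\<^sub>0 int) set monoid"
  where "free_qlie_degree H m =
    subgroup_generated (free_qlie H) (tree_bracket H ` rtrees_of_degree H m)"


section \<open>The homomorphism \<open>\<eta>'\<close>\<close>

text \<open>
  The sum over univalent vertices, in multiplicative notation: vertices that give the same
  label and the same rooted tree are collected by the exponent.
\<close>

definition eta_tree ::
    "('h, 'm) monoid_scheme \<Rightarrow> nat \<Rightarrow> 'h utree \<Rightarrow> ('h \<times> ('h rtree \<Rightarrow>\<^sub>0 int) set \<Rightarrow>\<^sub>0 int) set"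
  where "eta_tree H n T =
    (\<Otimes>\<^bsub>tensor_group H (free_qlie_degree H (n + 1))\<^esub>p\<in>set_mset (rootings T).
       pure_tensor H (free_qlie_degree H (n + 1)) (fst p) (tree_bracket H (snd p))
         [^]\<^bsub>tensor_group H (free_qlie_degree H (n + 1))\<^esub> count (rootings T) p)"

definition eta ::
    "('h, 'm) monoid_scheme \<Rightarrow> nat \<Rightarrow> ('h utree \<Rightarrow>\<^sub>0 int) set
       \<Rightarrow> ('h \<times> ('h rtree \<Rightarrow>\<^sub>0 int) set \<Rightarrow>\<^sub>0 int) set"
  where "eta H n =
    presented_map (tensor_group H (free_qlie_degree H (n + 1))) (eta_tree H n)"

section \<open>The maps are well-defined homomorphisms\<close>

lemma free_map_eq:
  assumes "comm_group G" "f \<in> S \<rightarrow> carrier G" "finite A" "A \<subseteq> S" "Poly_Mapping.keys x \<subseteq> A"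
  shows "free_map G f x = (\<Otimes>\<^bsub>G\<^esub>s\<in>A. f s [^]\<^bsub>G\<^esub> Poly_Mapping.lookup x s)"
proof -
  interpret comm_group G by fact
  show ?thesis
    unfolding free_map_def
    by (rule finprod_mono_neutral_cong_left)
      (use assms in \<open>auto simp: in_keys_iff Pi_iff subset_iff\<close>)
qed

lemma free_map_hom:
  assumes "comm_group G" "f \<in> S \<rightarrow> carrier G"
  shows "free_map G f \<in> hom (free_Abelian_group S) G"
proof -
  interpret comm_group G by fact
  show ?thesis
  proof (rule homI)
    fix x assume x: "x \<in> carrier (free_Abelian_group S)"
    then show "free_map G f x \<in> carrier G"
      unfolding free_map_def using assms(2) by (intro finprod_closed) auto
    fix y assume y: "y \<in> carrier (free_Abelian_group S)"
    let ?A = "Poly_Mapping.keys x \<union> Poly_Mapping.keys y"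
    have A: "finite ?A" "?A \<subseteq> S" using x y by auto
    have k: "Poly_Mapping.keys (x + y) \<subseteq> ?A" by (rule keys_add)
    have c: "f s \<in> carrier G" if "s \<in> ?A" for s using that A assms(2) by auto
    have "free_map G f (x + y) =
      (\<Otimes>\<^bsub>G\<^esub>s\<in>?A. f s [^]\<^bsub>G\<^esub> Poly_Mapping.lookup x s \<otimes>\<^bsub>G\<^esub> f s [^]\<^bsub>G\<^esub> Poly_Mapping.lookup y s)"
      unfolding free_map_eq[OF assms A k]
      by (rule finprod_cong') (auto simp: Poly_Mapping.lookup_add int_pow_mult c)
    also have "\<dots> = free_map G f x \<otimes>\<^bsub>G\<^esub> free_map G f y"
      using free_map_eq[OF assms A, of x] free_map_eq[OF assms A, of y]
      by (subst finprod_multf) (auto simp: c)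
    finally show "free_map G f (x \<otimes>\<^bsub>free_Abelian_group S\<^esub> y) = free_map G f x \<otimes>\<^bsub>G\<^esub> free_map G f y"
      by simp
  qed
qed

lemma free_group_hom:
  "group G \<Longrightarrow> h \<in> hom (free_Abelian_group S) G \<Longrightarrow> group_hom (free_Abelian_group S) G h"
  by (simp add: group_hom_def group_hom_axioms_def)

lemma free_map_of:
  assumes "comm_group G" "f s \<in> carrier G"
  shows "free_map G f (frag_of s) = f s"
proof -
  interpret comm_group G by fact
  show ?thesis using assms(2) by (simp add: free_map_def)
qed

lemma free_map_0: "comm_group G \<Longrightarrow> free_map G f 0 = \<one>\<^bsub>G\<^esub>"
proof -
  assume "comm_group G"
  then interpret comm_group G .
  show ?thesis by (simp add: free_map_def)
qed

lemma free_map_add: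
  assumes "comm_group G" "f \<in> S \<rightarrow> carrier G" "Poly_Mapping.keys x \<subseteq> S" "Poly_Mapping.keys y \<subseteq> S"
  shows "free_map G f (x + y) = free_map G f x \<otimes>\<^bsub>G\<^esub> free_map G f y"
  using hom_mult[OF free_map_hom[OF assms(1,2)], of x y] assms(3,4) by simp

lemma free_map_diff:
  assumes "comm_group G" "f \<in> S \<rightarrow> carrier G" "Poly_Mapping.keys x \<subseteq> S" "Poly_Mapping.keys y \<subseteq> S"
  shows "free_map G f (x - y) = free_map G f x \<otimes>\<^bsub>G\<^esub> inv\<^bsub>G\<^esub> free_map G f y"
proof -
  interpret comm_group G by fact
  interpret group_hom "free_Abelian_group S" G "free_map G f"
    by (intro free_group_hom free_map_hom assms group_axioms)
  have "free_map G f (x + - y) = free_map G f x \<otimes>\<^bsub>G\<^esub> free_map G f (- y)"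
    using assms by (intro free_map_add[where S = S]) auto
  moreover have "free_map G f (- y) = inv\<^bsub>G\<^esub> free_map G f y"
    using hom_inv[of y] assms(4) by simp
  ultimately show ?thesis by simp
qed

lemma presented_subgroup:
  assumes "R \<subseteq> carrier (free_Abelian_group S)"
  shows "subgroup (generate (free_Abelian_group S) R) (free_Abelian_group S)"
    "generate (free_Abelian_group S) R \<lhd> free_Abelian_group S"
proof -
  show *: "subgroup (generate (free_Abelian_group S) R) (free_Abelian_group S)"
    by (rule group.generate_is_subgroup) (use assms in auto)
  show "generate (free_Abelian_group S) R \<lhd> free_Abelian_group S"
    by (rule comm_group.subgroup_imp_normal[OF abelian_free_Abelian_group *])
qed

lemma presented_group_comm_group:
  assumes "R \<subseteq> carrier (free_Abelian_group S)"
  shows "comm_group (presented_group S R)"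
  unfolding presented_group_def
  by (rule comm_group.abelian_FactGroup[OF abelian_free_Abelian_group presented_subgroup(1)[OF assms]])

lemma presented_proj_hom:
  assumes "R \<subseteq> carrier (free_Abelian_group S)"
  shows "(\<lambda>x. generate (free_Abelian_group S) R #>\<^bsub>free_Abelian_group S\<^esub> x)
    \<in> hom (free_Abelian_group S) (presented_group S R)"
  unfolding presented_group_def
  by (rule normal.r_coset_hom_Mod[OF presented_subgroup(2)[OF assms]])

lemma presented_proj_rel:
  assumes "R \<subseteq> carrier (free_Abelian_group S)" "r \<in> R"
  shows "generate (free_Abelian_group S) R #>\<^bsub>free_Abelian_group S\<^esub> r = \<one>\<^bsub>presented_group S R\<^esub>"
  unfolding presented_group_def one_FactGroup
  by (rule group.coset_join2[OF group_free_Abelian_group])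
    (use assms presented_subgroup(1)[OF assms(1)] in \<open>blast intro: generate.incl\<close>)+

lemma presented_class_carrier:
  assumes "R \<subseteq> carrier (free_Abelian_group S)" "s \<in> S"
  shows "presented_class S R s \<in> carrier (presented_group S R)"
  unfolding presented_class_def
  by (rule hom_in_carrier[OF presented_proj_hom[OF assms(1)]]) (use assms in auto)

text \<open>The canonical projection is the free extension of \<^const>\<open>presented_class\<close>.\<close>

lemma free_map_presented_class:
  assumes "R \<subseteq> carrier (free_Abelian_group S)" "Poly_Mapping.keys x \<subseteq> S"
  shows "free_map (presented_group S R) (presented_class S R) x =
    generate (free_Abelian_group S) R #>\<^bsub>free_Abelian_group S\<^esub> x"
proof -
  let ?G = "presented_group S R"
  let ?p = "\<lambda>x. generate (free_Abelian_group S) R #>\<^bsub>free_Abelian_group S\<^esub> x"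
  have G: "comm_group ?G" using presented_group_comm_group[OF assms(1)] .
  then interpret comm_group ?G .
  interpret p: group_hom "free_Abelian_group S" ?G ?p
    by (intro free_group_hom presented_proj_hom assms group_axioms)
  have f: "presented_class S R \<in> S \<rightarrow> carrier ?G"
    using presented_class_carrier[OF assms(1)] by auto
  show ?thesis
  proof (rule free_Abelian_group_induct[OF assms(2)], goal_cases)
    case 1
    show ?case using p.hom_one by (simp add: free_map_0[OF G])
  next
    case (2 x y)
    have "?p (x + - y) = ?p x \<otimes>\<^bsub>?G\<^esub> ?p (- y)"
      using p.hom_mult[of x "- y"] 2 by simp
    also have "?p (- y) = inv\<^bsub>?G\<^esub> ?p y" using p.hom_inv[of y] 2 by simp
    finally show ?case using 2 by (simp add: free_map_diff[OF G f])
  next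
    case (3 a)
    then show ?case using f by (subst free_map_of[OF G]) (auto simp: presented_class_def)
  qed
qed

lemma presented_map_coset:
  assumes "comm_group G" "f \<in> S \<rightarrow> carrier G" "R \<subseteq> carrier (free_Abelian_group S)"
    and rel: "\<And>r. r \<in> R \<Longrightarrow> free_map G f r = \<one>\<^bsub>G\<^esub>"
    and x: "x \<in> carrier (free_Abelian_group S)"
  shows "presented_map G f (generate (free_Abelian_group S) R #>\<^bsub>free_Abelian_group S\<^esub> x) =
    free_map G f x"
proof -
  interpret comm_group G by fact
  interpret group_hom "free_Abelian_group S" G "free_map G f"
    by (intro free_group_hom free_map_hom assms group_axioms)
  let ?N = "generate (free_Abelian_group S) R"
  have "?N \<subseteq> kernel (free_Abelian_group S) G (free_map G f)"
    by (rule group.generate_subgroup_incl[OF group_free_Abelian_group _ subgroup_kernel])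
      (use assms(3) rel in \<open>auto simp: kernel_def subset_iff\<close>)
  then have "free_map G f (n + x) = free_map G f x"
    if "n \<in> ?N" for n
    using that x hom_mult[of n x] by (auto simp: kernel_def)
  moreover have "?N \<noteq> {}" using generate.one by blast
  ultimately have "free_map G f ` (?N #>\<^bsub>free_Abelian_group S\<^esub> x) = {free_map G f x}"
    by (auto simp: r_coset_def image_iff) 
  then show ?thesis by (simp add: presented_map_def)
qed

lemma presented_map_class:
  assumes "comm_group G" "f \<in> S \<rightarrow> carrier G" "R \<subseteq> carrier (free_Abelian_group S)"
    and "\<And>r. r \<in> R \<Longrightarrow> free_map G f r = \<one>\<^bsub>G\<^esub>" and "s \<in> S"
  shows "presented_map G f (presented_class S R s) = f s"
  using presented_map_coset[OF assms(1-4), of "frag_of s"] free_map_of[OF assms(1), of f s]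
    assms(2,5) by (auto simp: presented_class_def)

lemma presented_map_hom:
  assumes "comm_group G" "f \<in> S \<rightarrow> carrier G" "R \<subseteq> carrier (free_Abelian_group S)"
    and rel: "\<And>r. r \<in> R \<Longrightarrow> free_map G f r = \<one>\<^bsub>G\<^esub>"
  shows "presented_map G f \<in> hom (presented_group S R) G"
proof -
  interpret comm_group G by fact
  let ?N = "generate (free_Abelian_group S) R"
  let ?p = "\<lambda>x. ?N #>\<^bsub>free_Abelian_group S\<^esub> x"
  have co: "presented_map G f (?p x) = free_map G f x" if "x \<in> carrier (free_Abelian_group S)" for x
    using assms that by (rule presented_map_coset)
  have car: "carrier (presented_group S R) = ?p ` carrier (free_Abelian_group S)"
    by (simp add: presented_group_def carrier_FactGroup)
  show ?thesis
  proof (rule homI)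
    fix X assume "X \<in> carrier (presented_group S R)"
    then obtain x where x: "x \<in> carrier (free_Abelian_group S)" "X = ?p x" by (auto simp: car)
    then show "presented_map G f X \<in> carrier G"
      using hom_in_carrier[OF free_map_hom[OF assms(1,2)] x(1)] co by simp
    fix Y assume "Y \<in> carrier (presented_group S R)"
    then obtain y where y: "y \<in> carrier (free_Abelian_group S)" "Y = ?p y" by (auto simp: car)
    have xy: "x \<otimes>\<^bsub>free_Abelian_group S\<^esub> y \<in> carrier (free_Abelian_group S)"
      using x(1) y(1) by (intro monoid.m_closed group.is_monoid) auto
    have "X \<otimes>\<^bsub>presented_group S R\<^esub> Y = ?p (x \<otimes>\<^bsub>free_Abelian_group S\<^esub> y)"
      using hom_mult[OF presented_proj_hom[OF assms(3)] x(1) y(1)] x y by simp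
    then show "presented_map G f (X \<otimes>\<^bsub>presented_group S R\<^esub> Y) =
        presented_map G f X \<otimes>\<^bsub>G\<^esub> presented_map G f Y"
      using co[OF xy] co[OF x(1)] co[OF y(1)] x y hom_mult[OF free_map_hom[OF assms(1,2)] x(1) y(1)]
      by simp
  qed
qed

lemma size_rtree_labels: "size (rtree_labels t) = Suc (rtree_nodes t)"
  by (induction t) auto

lemma size_labels: "size (labels T) = trivalent T + 2"
proof -
  obtain s t where "T = glue s t" by (rule utree_cases)
  then show ?thesis by (simp add: labels_glue trivalent_glue size_rtree_labels)
qed

lemma as_rels_carrier:
  assumes "\<And>a b c. glue (Node a b) c \<in> S \<Longrightarrow> glue (Node b a) c \<in> S"
  shows "as_rels S \<subseteq> carrier (free_Abelian_group S)"
proof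
  fix r assume "r \<in> as_rels S"
  then obtain a b c where r: "r = frag_of (glue (Node a b) c) + frag_of (glue (Node b a) c)"
    and "glue (Node a b) c \<in> S" unfolding as_rels_def by blast
  moreover from this(2) have "glue (Node b a) c \<in> S" by (rule assms)
  ultimately show "r \<in> carrier (free_Abelian_group S)"
    by (auto dest!: subsetD[OF keys_add])
qed

lemma ihx_rels_carrier:
  assumes "\<And>A B C D. ihx_tree A B C D \<in> S \<Longrightarrow> ihx_tree B C A D \<in> S \<and> ihx_tree C A B D \<in> S"
  shows "ihx_rels S \<subseteq> carrier (free_Abelian_group S)"
proof
  fix r assume "r \<in> ihx_rels S"
  then obtain A B C D where r: "r = frag_of (ihx_tree A B C D) + frag_of (ihx_tree B C A D)
      + frag_of (ihx_tree C A B D)" and S: "ihx_tree A B C D \<in> S"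
    unfolding ihx_rels_def by blast
  from r S assms[OF S] show "r \<in> carrier (free_Abelian_group S)"
    by (auto dest!: subsetD[OF keys_add])
qed

lemma tree_rels_carrier: "tree_rels H n \<subseteq> carrier (free_Abelian_group (trees H n))"
proof -
  have "as_rels (trees H n) \<subseteq> carrier (free_Abelian_group (trees H n))"
    by (rule as_rels_carrier) (auto simp: trees_def labels_glue trivalent_glue)
  moreover have "ihx_rels (trees H n) \<subseteq> carrier (free_Abelian_group (trees H n))"
    by (rule ihx_rels_carrier) (auto simp: trees_def ihx_tree_def labels_glue trivalent_glue)
  moreover have "linear_rels H (trees H n) \<subseteq> carrier (free_Abelian_group (trees H n))"
    unfolding linear_rels_def
    by (auto dest!: subsetD[OF keys_diff] simp: trees_def labels_glue trivalent_glue subset_iff)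
  ultimately show ?thesis by (auto simp: tree_rels_def)
qed

lemma sig_rels_carrier: "sig_rels \<alpha> d \<omega> \<subseteq> carrier (free_Abelian_group (sig_trees \<alpha> d \<omega>))"
proof -
  have "as_rels (sig_trees \<alpha> d \<omega>) \<subseteq> carrier (free_Abelian_group (sig_trees \<alpha> d \<omega>))"
    by (rule as_rels_carrier) (simp add: sig_trees_def labels_glue add_ac)
  moreover have "ihx_rels (sig_trees \<alpha> d \<omega>) \<subseteq> carrier (free_Abelian_group (sig_trees \<alpha> d \<omega>))"
    by (rule ihx_rels_carrier) (simp add: sig_trees_def ihx_tree_def labels_glue add_ac)
  ultimately show ?thesis by (auto simp: sig_rels_def)
qed

lemma tree_group_comm_group: "comm_group (tree_group H n)"
  unfolding tree_group_def by (rule presented_group_comm_group[OF tree_rels_carrier])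

lemma sig_tree_group_comm_group: "comm_group (sig_tree_group \<alpha> d \<omega>)"
  unfolding sig_tree_group_def by (rule presented_group_comm_group[OF sig_rels_carrier])

lemma free_basis_inj:
  assumes "comm_group H" "free_basis H \<alpha> d"
  shows "inj_on \<alpha> {1..d}"
proof (rule inj_onI, rule ccontr)
  interpret comm_group H by fact
  fix i j assume ij: "i \<in> {1..d}" "j \<in> {1..d}" "\<alpha> i = \<alpha> j" "i \<noteq> j"
  have car: "\<alpha> k \<in> carrier H" if "k \<in> {1..d}" for k
    using assms(2) that by (auto simp: free_basis_def)
  define c where "c = (\<lambda>k. \<lambda>l\<in>{1..d}. if l = k then 1 else 0 :: int)"
  have c: "c k \<in> {1..d} \<rightarrow>\<^sub>E UNIV \<and>
      \<alpha> k = (\<Otimes>\<^bsub>H\<^esub>l\<in>{1..d}. \<alpha> l [^]\<^bsub>H\<^esub> c k l)" if "k \<in> {1..d}" for k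
  proof -
    have "(\<Otimes>\<^bsub>H\<^esub>l\<in>{1..d}. \<alpha> l [^]\<^bsub>H\<^esub> c k l) = (\<Otimes>\<^bsub>H\<^esub>l\<in>{1..d}. if k = l then \<alpha> l else \<one>\<^bsub>H\<^esub>)"
      by (rule finprod_cong') (auto simp: c_def car)
    also have "\<dots> = \<alpha> k" using that car by (subst finprod_singleton) auto
    finally show ?thesis by (auto simp: c_def)
  qed
  have "\<exists>!c. c \<in> {1..d} \<rightarrow>\<^sub>E UNIV \<and> \<alpha> i = (\<Otimes>\<^bsub>H\<^esub>l\<in>{1..d}. \<alpha> l [^]\<^bsub>H\<^esub> (c l :: int))"
    using assms(2) car[OF ij(1)] by (auto simp: free_basis_def)
  then have "c i = c j" using c[OF ij(1)] c[OF ij(2)] ij(3) by metis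
  then have "c i i = c j i" by simp
  with ij show False by (simp add: c_def)
qed

lemma sig_trees_subset:
  assumes "comm_group H" "free_basis H \<alpha> d" "(\<Sum>i=1..d. \<omega> i) = n + 2"
  shows "sig_trees \<alpha> d \<omega> \<subseteq> trees H n"
proof
  fix T assume T: "T \<in> sig_trees \<alpha> d \<omega>"
  have "size (labels T) = (\<Sum>a\<in>\<alpha> ` {1..d}. count (labels T) a)"
    unfolding size_multiset_overloaded_eq
    by (rule sum.mono_neutral_left) (use T in \<open>auto simp: sig_trees_def count_eq_zero_iff\<close>)
  also have "\<dots> = (\<Sum>i=1..d. \<omega> i)"
    using T by (subst sum.reindex[OF free_basis_inj[OF assms(1,2)]]) (simp add: sig_trees_def)
  finally have "trivalent T = n" using assms(3) by (simp add: size_labels)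
  then show "T \<in> trees H n"
    using T assms(2) by (auto simp: sig_trees_def trees_def free_basis_def)
qed

lemma
  assumes "comm_group H" "free_basis H \<alpha> d" "(\<Sum>i=1..d. \<omega> i) = n + 2"
  shows sig_inclusion_hom: "sig_inclusion H n \<in> hom (sig_tree_group \<alpha> d \<omega>) (tree_group H n)"
    and sig_inclusion_class: "T \<in> sig_trees \<alpha> d \<omega> \<Longrightarrow>
      sig_inclusion H n (presented_class (sig_trees \<alpha> d \<omega>) (sig_rels \<alpha> d \<omega>) T) =
      presented_class (trees H n) (tree_rels H n) T"
proof -
  note sub = sig_trees_subset[OF assms]
  let ?p = "presented_class (trees H n) (tree_rels H n)"
  have p: "?p \<in> sig_trees \<alpha> d \<omega> \<rightarrow> carrier (tree_group H n)"
    using presented_class_carrier[OF tree_rels_carrier] sub by (auto simp: tree_group_def)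
  have "sig_rels \<alpha> d \<omega> \<subseteq> tree_rels H n"
    using sub by (auto simp: sig_rels_def tree_rels_def as_rels_def ihx_rels_def)
  then have rel: "free_map (tree_group H n) ?p r = \<one>\<^bsub>tree_group H n\<^esub>" if "r \<in> sig_rels \<alpha> d \<omega>" for r
  proof -
    have "r \<in> tree_rels H n" using that \<open>sig_rels \<alpha> d \<omega> \<subseteq> tree_rels H n\<close> by blast
    moreover from this have "Poly_Mapping.keys r \<subseteq> trees H n"
      using tree_rels_carrier[of H n] by (auto simp del: carrier_free_Abelian_group_iff
          simp flip: carrier_free_Abelian_group_iff)
    ultimately show ?thesis unfolding tree_group_def
      by (simp add: free_map_presented_class[OF tree_rels_carrier] presented_proj_rel[OF tree_rels_carrier])
  qed
  show "sig_inclusion H n \<in> hom (sig_tree_group \<alpha> d \<omega>) (tree_group H n)"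
    unfolding sig_inclusion_def sig_tree_group_def
    by (rule presented_map_hom[OF tree_group_comm_group p sig_rels_carrier rel])
  show "sig_inclusion H n (presented_class (sig_trees \<alpha> d \<omega>) (sig_rels \<alpha> d \<omega>) T) = ?p T"
    if "T \<in> sig_trees \<alpha> d \<omega>"
    unfolding sig_inclusion_def
    by (rule presented_map_class[OF tree_group_comm_group p sig_rels_carrier rel that])
qed

lemma tensor_rels_carrier:
  assumes "comm_group G" "comm_group K"
  shows "tensor_rels G K \<subseteq> carrier (free_Abelian_group (carrier G \<times> carrier K))"
proof -
  interpret G: comm_group G by fact
  interpret K: comm_group K by fact
  show ?thesis unfolding tensor_rels_def by (auto dest!: subsetD[OF keys_diff])
qed

lemma tensor_group_comm_group:
  "comm_group G \<Longrightarrow> comm_group K \<Longrightarrow> comm_group (tensor_group G K)"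
  unfolding tensor_group_def by (rule presented_group_comm_group[OF tensor_rels_carrier])

lemma pure_tensor_carrier:
  assumes "comm_group G" "comm_group K" "g \<in> carrier G" "k \<in> carrier K"
  shows "pure_tensor G K g k \<in> carrier (tensor_group G K)"
  unfolding tensor_group_def pure_tensor_def
  by (rule presented_class_carrier[OF tensor_rels_carrier]) (use assms in auto)

lemma tensor_diff_rel:
  assumes G: "comm_group G" "comm_group K"
    and "a \<in> carrier G \<times> carrier K" "b \<in> carrier G \<times> carrier K" "c \<in> carrier G \<times> carrier K"
    and r: "frag_of a - frag_of b - frag_of c \<in> tensor_rels G K"
  shows "pure_tensor G K (fst a) (snd a) =
    pure_tensor G K (fst b) (snd b) \<otimes>\<^bsub>tensor_group G K\<^esub> pure_tensor G K (fst c) (snd c)"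
proof -
  let ?S = "carrier G \<times> carrier K" and ?R = "tensor_rels G K" and ?P = "tensor_group G K"
  let ?f = "presented_class ?S ?R"
  note R = tensor_rels_carrier[OF G]
  have P: "comm_group ?P" by (rule tensor_group_comm_group[OF G])
  interpret comm_group ?P by fact
  have f: "?f \<in> ?S \<rightarrow> carrier ?P"
    using presented_class_carrier[OF R] by (auto simp: tensor_group_def)
  have k: "Poly_Mapping.keys (frag_of a - frag_of b - frag_of c) \<subseteq> ?S"
    using R r by (auto simp del: carrier_free_Abelian_group_iff
          simp flip: carrier_free_Abelian_group_iff)
  have "free_map ?P ?f (frag_of a - (frag_of b + frag_of c)) = \<one>\<^bsub>?P\<^esub>"
    using free_map_presented_class[OF R k] presented_proj_rel[OF R r] unfolding tensor_group_def
    by (simp add: algebra_simps)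
  moreover have "free_map ?P ?f (frag_of a - (frag_of b + frag_of c)) =
      ?f a \<otimes>\<^bsub>?P\<^esub> inv\<^bsub>?P\<^esub> (?f b \<otimes>\<^bsub>?P\<^esub> ?f c)"
    using assms f keys_add[of "frag_of b" "frag_of c"]
    by (subst free_map_diff[OF P f]; (subst free_map_add[OF P f])?)
      (auto simp: free_map_of[OF P] Pi_iff)
  moreover have "?f a \<in> carrier ?P" "?f b \<otimes>\<^bsub>?P\<^esub> ?f c \<in> carrier ?P" using f assms by auto
  ultimately have "?f a = ?f b \<otimes>\<^bsub>?P\<^esub> ?f c"
    by (metis inv_closed inv_equality inv_inv)
  then show ?thesis by (simp add: pure_tensor_def)
qed

lemma pure_tensor_hom_right:
  assumes "comm_group G" "comm_group K" "g \<in> carrier G"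
  shows "pure_tensor G K g \<in> hom K (tensor_group G K)"
proof (rule homI)
  interpret K: comm_group K by fact
  fix x y assume xy: "x \<in> carrier K" "y \<in> carrier K"
  show "pure_tensor G K g x \<in> carrier (tensor_group G K)"
    by (rule pure_tensor_carrier[OF assms xy(1)])
  have "frag_of (g, x \<otimes>\<^bsub>K\<^esub> y) - frag_of (g, x) - frag_of (g, y) \<in> tensor_rels G K"
    using assms(3) xy unfolding tensor_rels_def by blast
  from tensor_diff_rel[OF assms(1,2) _ _ _ this] assms(3) xy
  show "pure_tensor G K g (x \<otimes>\<^bsub>K\<^esub> y) =
      pure_tensor G K g x \<otimes>\<^bsub>tensor_group G K\<^esub> pure_tensor G K g y" by simp
qed

lemma pure_tensor_hom_left:
  assumes "comm_group G" "comm_group K" "k \<in> carrier K"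
  shows "(\<lambda>g. pure_tensor G K g k) \<in> hom G (tensor_group G K)"
proof (rule homI)
  interpret G: comm_group G by fact
  fix x y assume xy: "x \<in> carrier G" "y \<in> carrier G"
  show "pure_tensor G K x k \<in> carrier (tensor_group G K)"
    by (rule pure_tensor_carrier[OF assms(1,2) xy(1) assms(3)])
  have "frag_of (x \<otimes>\<^bsub>G\<^esub> y, k) - frag_of (x, k) - frag_of (y, k) \<in> tensor_rels G K"
    using assms(3) xy unfolding tensor_rels_def by blast
  from tensor_diff_rel[OF assms(1,2) _ _ _ this] assms(3) xy
  show "pure_tensor G K (x \<otimes>\<^bsub>G\<^esub> y) k =
      pure_tensor G K x k \<otimes>\<^bsub>tensor_group G K\<^esub> pure_tensor G K y k" by simp
qed

lemma frag_bracket_of [simp]: "frag_bracket (frag_of s) (frag_of t) = frag_of (Node s t)"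
  by (simp add: frag_bracket_def)

lemma frag_bracket_add_left: "frag_bracket (x + x') y = frag_bracket x y + frag_bracket x' y"
  by (simp add: frag_bracket_def frag_extend_add)

lemma frag_bracket_diff_left: "frag_bracket (x - x') y = frag_bracket x y - frag_bracket x' y"
  by (simp add: frag_bracket_def frag_extend_diff)

lemma frag_extend_fun_add:
  "frag_extend (\<lambda>s. f s + g s) x = frag_extend f x + frag_extend g x"
  by (simp add: frag_extend_def frag_cmul_distrib2 sum.distrib)

lemma frag_extend_fun_diff:
  "frag_extend (\<lambda>s. f s - g s) x = frag_extend f x - frag_extend g x"
  using frag_extend_fun_add[of "\<lambda>s. f s - g s" g x] by (simp add: algebra_simps)

lemma frag_bracket_add_right: "frag_bracket x (y + y') = frag_bracket x y + frag_bracket x y'"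
  by (simp add: frag_bracket_def frag_extend_add frag_extend_fun_add)

lemma frag_bracket_diff_right: "frag_bracket x (y - y') = frag_bracket x y - frag_bracket x y'"
  by (simp add: frag_bracket_def frag_extend_diff frag_extend_fun_diff)

lemma keys_frag_bracket:
  "Poly_Mapping.keys (frag_bracket x y) \<subseteq>
    {Node s t | s t. s \<in> Poly_Mapping.keys x \<and> t \<in> Poly_Mapping.keys y}"
  unfolding frag_bracket_def
  by (auto dest!: subsetD[OF keys_frag_extend])

lemma frag_bracket_carrier:
  assumes "Poly_Mapping.keys x \<subseteq> rtrees H" "Poly_Mapping.keys y \<subseteq> rtrees H"
  shows "Poly_Mapping.keys (frag_bracket x y) \<subseteq> rtrees H"
  using keys_frag_bracket[of x y] assms by (fastforce simp: rtrees_def)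

lemma qlie_ideal_carrier:
  assumes "comm_group H" "x \<in> qlie_ideal H"
  shows "Poly_Mapping.keys x \<subseteq> rtrees H"
proof -
  interpret comm_group H by fact
  note * = subsetD[OF keys_add] subsetD[OF keys_diff]
  show ?thesis using assms(2)
  proof induction
    case (linear h k)
    then show ?case by (auto dest!: * simp: rtrees_def)
  next
    case (antisym x y)
    then have "Poly_Mapping.keys (frag_bracket x y) \<subseteq> rtrees H"
      "Poly_Mapping.keys (frag_bracket y x) \<subseteq> rtrees H" by (simp_all add: frag_bracket_carrier)
    then show ?case by (auto dest!: *)
  next
    case (jacobi x y z)
    then have "Poly_Mapping.keys (frag_bracket (frag_bracket x y) z) \<subseteq> rtrees H"
      "Poly_Mapping.keys (frag_bracket (frag_bracket y z) x) \<subseteq> rtrees H"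
      "Poly_Mapping.keys (frag_bracket (frag_bracket z x) y) \<subseteq> rtrees H"
      by (simp_all add: frag_bracket_carrier)
    then show ?case by (auto dest!: *)
  next
    case (diff x y)
    then show ?case by (auto dest!: *)
  qed (simp_all add: frag_bracket_carrier)
qed

lemma qlie_ideal_minus: "x \<in> qlie_ideal H \<Longrightarrow> - x \<in> qlie_ideal H"
  using qlie_ideal.diff[OF qlie_ideal.zero, of x] by simp

lemma qlie_ideal_add: "x \<in> qlie_ideal H \<Longrightarrow> y \<in> qlie_ideal H \<Longrightarrow> x + y \<in> qlie_ideal H"
  using qlie_ideal.diff[of x H "- y"] qlie_ideal_minus[of y H] by simp

lemma qlie_ideal_subgroup:
  assumes "comm_group H"
  shows "subgroup (qlie_ideal H) (free_Abelian_group (rtrees H))"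
  by (rule group.subgroupI[OF group_free_Abelian_group])
    (use qlie_ideal_carrier[OF assms] in \<open>auto intro: qlie_ideal.zero qlie_ideal_add qlie_ideal_minus\<close>)

lemma free_qlie_comm_group: "comm_group H \<Longrightarrow> comm_group (free_qlie H)"
  unfolding free_qlie_def
  by (rule comm_group.abelian_FactGroup[OF abelian_free_Abelian_group qlie_ideal_subgroup])

lemma qlie_class_hom:
  "comm_group H \<Longrightarrow> qlie_class H \<in> hom (free_Abelian_group (rtrees H)) (free_qlie H)"
  unfolding free_qlie_def qlie_class_def
  by (intro normal.r_coset_hom_Mod comm_group.subgroup_imp_normal[OF abelian_free_Abelian_group]
        qlie_ideal_subgroup)

lemma mem_qlie_class: "z \<in> qlie_class H x \<longleftrightarrow> z - x \<in> qlie_ideal H"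
  by (auto simp: qlie_class_def r_coset_def intro!: bexI[of _ "z - x"])

lemma qlie_class_eq: "qlie_class H x = qlie_class H y \<longleftrightarrow> x - y \<in> qlie_ideal H"
proof
  assume "qlie_class H x = qlie_class H y"
  moreover have "x \<in> qlie_class H x" by (simp add: mem_qlie_class qlie_ideal.zero)
  ultimately show "x - y \<in> qlie_ideal H" by (simp add: mem_qlie_class)
next
  assume *: "x - y \<in> qlie_ideal H"
  show "qlie_class H x = qlie_class H y"
    using qlie_ideal_add[OF _ *] qlie_ideal.diff[OF _ *]
    by (force simp: mem_qlie_class)
qed

lemma qlie_bracket_class:
  assumes "comm_group H" "Poly_Mapping.keys x \<subseteq> rtrees H" "Poly_Mapping.keys y \<subseteq> rtrees H"
  shows "qlie_bracket H (qlie_class H x) (qlie_class H y) = qlie_class H (frag_bracket x y)"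
proof -
  have "qlie_class H (frag_bracket x' y') = qlie_class H (frag_bracket x y)"
    if *: "x' \<in> qlie_class H x" "y' \<in> qlie_class H y" for x' y'
  proof -
    have x: "x' - x \<in> qlie_ideal H" and y: "y' - y \<in> qlie_ideal H"
      using * by (auto simp: mem_qlie_class)
    have "Poly_Mapping.keys (x + (x' - x)) \<subseteq> rtrees H"
      using keys_add[of x "x' - x"] qlie_ideal_carrier[OF assms(1) x] assms(2) by blast
    then have "frag_bracket x' (y' - y) \<in> qlie_ideal H"
      using y by (intro qlie_ideal.left) auto
    moreover have "frag_bracket (x' - x) y \<in> qlie_ideal H"
      using x assms(3) by (intro qlie_ideal.right) auto
    ultimately have "frag_bracket x' (y' - y) + frag_bracket (x' - x) y \<in> qlie_ideal H"
      by (rule qlie_ideal_add)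
    then show ?thesis
      by (simp add: qlie_class_eq frag_bracket_diff_left frag_bracket_diff_right)
  qed
  moreover have "x \<in> qlie_class H x" "y \<in> qlie_class H y"
    by (simp_all add: mem_qlie_class qlie_ideal.zero)
  ultimately show ?thesis unfolding qlie_bracket_def by blast
qed

lemma tree_bracket_class:
  assumes "comm_group H" "t \<in> rtrees H"
  shows "tree_bracket H t = qlie_class H (frag_of t)"
  using assms(2)
proof (induction t)
  case (Node s t)
  then have "s \<in> rtrees H" "t \<in> rtrees H" by (auto simp: rtrees_def)
  with Node.IH show ?case using qlie_bracket_class[OF assms(1), of "frag_of s" "frag_of t"] by simp
qed simp

lemma free_qlie_degree_comm_group:
  assumes "comm_group H"
  shows "comm_group (free_qlie_degree H m)"
proof -
  interpret comm_group "free_qlie H" by (rule free_qlie_comm_group[OF assms])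
  show ?thesis
    unfolding free_qlie_degree_def
    by (rule group.group_comm_groupI)
      (use generate_incl[of "carrier (free_qlie H) \<inter> _"] in
        \<open>auto simp: carrier_subgroup_generated intro!: m_comm dest!: subsetD[OF generate_incl, rotated]\<close>)
qed

lemma qlie_class_diff:
  assumes "comm_group H" "Poly_Mapping.keys x \<subseteq> rtrees H" "Poly_Mapping.keys y \<subseteq> rtrees H"
  shows "qlie_class H (x - y) =
    qlie_class H x \<otimes>\<^bsub>free_qlie H\<^esub> inv\<^bsub>free_qlie H\<^esub> qlie_class H y"
proof -
  interpret comm_group "free_qlie H" by (rule free_qlie_comm_group[OF assms(1)])
  interpret group_hom "free_Abelian_group (rtrees H)" "free_qlie H" "qlie_class H"
    by (intro free_group_hom qlie_class_hom assms group_axioms)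
  show ?thesis using hom_mult[of x "- y"] hom_inv[of y] assms by simp
qed

lemma rtrees_of_degree_subset: "rtrees_of_degree H m \<subseteq> rtrees H"
  by (auto simp: rtrees_of_degree_def)

lemma qlie_class_carrier:
  assumes "comm_group H" "Poly_Mapping.keys x \<subseteq> rtrees H"
  shows "qlie_class H x \<in> carrier (free_qlie H)"
  using hom_in_carrier[OF qlie_class_hom[OF assms(1)], of x] assms(2) by simp

lemma free_qlie_cases:
  assumes "U \<in> carrier (free_qlie H)"
  obtains x where "Poly_Mapping.keys x \<subseteq> rtrees H" "U = qlie_class H x"
  using assms by (auto simp: free_qlie_def carrier_FactGroup qlie_class_def)

lemma free_qlie_mult_class:
  assumes "comm_group H" "Poly_Mapping.keys x \<subseteq> rtrees H" "Poly_Mapping.keys y \<subseteq> rtrees H"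
  shows "qlie_class H x \<otimes>\<^bsub>free_qlie H\<^esub> qlie_class H y = qlie_class H (x + y)"
  using hom_mult[OF qlie_class_hom[OF assms(1)], of x y] assms by simp

lemma free_qlie_one: "\<one>\<^bsub>free_qlie H\<^esub> = qlie_class H 0"
  using mem_qlie_class[of _ H 0] by (auto simp: free_qlie_def)

text \<open>\<open>free_qlie H\<close> with \<open>qlie_bracket H\<close> is a quasi-Lie algebra that receives \<open>H\<close> additively.\<close>

lemma qlie_bracket_laws:
  assumes "comm_group H" and U: "U \<in> carrier (free_qlie H)" and V: "V \<in> carrier (free_qlie H)"
    and W: "W \<in> carrier (free_qlie H)"
  shows "qlie_bracket H U V \<in> carrier (free_qlie H)"
    and "qlie_bracket H (U \<otimes>\<^bsub>free_qlie H\<^esub> V) W =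
      qlie_bracket H U W \<otimes>\<^bsub>free_qlie H\<^esub> qlie_bracket H V W"
    and "qlie_bracket H U (V \<otimes>\<^bsub>free_qlie H\<^esub> W) =
      qlie_bracket H U V \<otimes>\<^bsub>free_qlie H\<^esub> qlie_bracket H U W"
    and "qlie_bracket H U V \<otimes>\<^bsub>free_qlie H\<^esub> qlie_bracket H V U = \<one>\<^bsub>free_qlie H\<^esub>"
    and "qlie_bracket H (qlie_bracket H U V) W \<otimes>\<^bsub>free_qlie H\<^esub>
      qlie_bracket H (qlie_bracket H V W) U \<otimes>\<^bsub>free_qlie H\<^esub>
      qlie_bracket H (qlie_bracket H W U) V = \<one>\<^bsub>free_qlie H\<^esub>"
proof -
  obtain x where x: "Poly_Mapping.keys x \<subseteq> rtrees H" "U = qlie_class H x"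
    using U by (rule free_qlie_cases)
  obtain y where y: "Poly_Mapping.keys y \<subseteq> rtrees H" "V = qlie_class H y"
    using V by (rule free_qlie_cases)
  obtain z where z: "Poly_Mapping.keys z \<subseteq> rtrees H" "W = qlie_class H z"
    using W by (rule free_qlie_cases)
  have add: "Poly_Mapping.keys (a + b) \<subseteq> rtrees H"
    if "Poly_Mapping.keys a \<subseteq> rtrees H" "Poly_Mapping.keys b \<subseteq> rtrees H"
    for a b :: "'a rtree \<Rightarrow>\<^sub>0 int"
    using that by (intro order_trans[OF keys_add] Un_least)
  note [simp] = x(2) y(2) z(2) x(1) y(1) z(1) add frag_bracket_carrier
    qlie_bracket_class[OF assms(1)] free_qlie_mult_class[OF assms(1)]
    qlie_class_carrier[OF assms(1)] free_qlie_one qlie_class_eq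
  show "qlie_bracket H U V \<in> carrier (free_qlie H)"
    by simp
  show "qlie_bracket H (U \<otimes>\<^bsub>free_qlie H\<^esub> V) W =
      qlie_bracket H U W \<otimes>\<^bsub>free_qlie H\<^esub> qlie_bracket H V W"
    by (simp add: frag_bracket_add_left qlie_ideal.zero)
  show "qlie_bracket H U (V \<otimes>\<^bsub>free_qlie H\<^esub> W) =
      qlie_bracket H U V \<otimes>\<^bsub>free_qlie H\<^esub> qlie_bracket H U W"
    by (simp add: frag_bracket_add_right qlie_ideal.zero)
  show "qlie_bracket H U V \<otimes>\<^bsub>free_qlie H\<^esub> qlie_bracket H V U = \<one>\<^bsub>free_qlie H\<^esub>"
    by (simp add: qlie_ideal.antisym)
  show "qlie_bracket H (qlie_bracket H U V) W \<otimes>\<^bsub>free_qlie H\<^esub>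
      qlie_bracket H (qlie_bracket H V W) U \<otimes>\<^bsub>free_qlie H\<^esub>
      qlie_bracket H (qlie_bracket H W U) V = \<one>\<^bsub>free_qlie H\<^esub>"
    by (simp add: qlie_ideal.jacobi)
qed

lemma qlie_class_Leaf_hom:
  assumes "comm_group H"
  shows "(\<lambda>h. qlie_class H (frag_of (Leaf h))) \<in> hom H (free_qlie H)"
proof (rule homI)
  fix h k assume hk: "h \<in> carrier H" "k \<in> carrier H"
  show "qlie_class H (frag_of (Leaf h)) \<in> carrier (free_qlie H)"
    using hk by (intro qlie_class_carrier[OF assms]) (simp add: rtrees_def)
  have "qlie_class H (frag_of (Leaf (h \<otimes>\<^bsub>H\<^esub> k))) = qlie_class H (frag_of (Leaf h) + frag_of (Leaf k))"
    using qlie_ideal.linear[OF hk] by (simp add: qlie_class_eq diff_diff_add)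
  then show "qlie_class H (frag_of (Leaf (h \<otimes>\<^bsub>H\<^esub> k))) =
      qlie_class H (frag_of (Leaf h)) \<otimes>\<^bsub>free_qlie H\<^esub> qlie_class H (frag_of (Leaf k))"
    using hk by (subst free_qlie_mult_class[OF assms]) (auto simp: rtrees_def)
qed

lemma qlie_class_degree:
  assumes "comm_group H" "Poly_Mapping.keys x \<subseteq> rtrees_of_degree H m"
  shows "qlie_class H x \<in> carrier (free_qlie_degree H m)"
proof -
  interpret comm_group "free_qlie H" by (rule free_qlie_comm_group[OF assms(1)])
  interpret h: group_hom "free_Abelian_group (rtrees H)" "free_qlie H" "qlie_class H"
    by (intro free_group_hom qlie_class_hom assms group_axioms)
  let ?B = "carrier (free_qlie H) \<inter> tree_bracket H ` rtrees_of_degree H m"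
  have sub: "subgroup (generate (free_qlie H) ?B) (free_qlie H)"
    by (rule generate_is_subgroup) blast
  have "qlie_class H x \<in> generate (free_qlie H) ?B"
  proof (rule free_Abelian_group_induct[OF assms(2)], goal_cases)
    case 1
    show ?case using h.hom_one generate.one[of "free_qlie H"] by simp
  next
    case (2 x y)
    then have "Poly_Mapping.keys x \<subseteq> rtrees H" "Poly_Mapping.keys y \<subseteq> rtrees H"
      using rtrees_of_degree_subset[of H m] by auto
    with 2 show ?case
      by (simp add: qlie_class_diff[OF assms(1)] subgroup.m_closed[OF sub] subgroup.m_inv_closed[OF sub])
  next
    case (3 t)
    then have "t \<in> rtrees H" using rtrees_of_degree_subset[of H m] by auto
    with 3 have "qlie_class H (frag_of t) \<in> ?B"
      using tree_bracket_class[OF assms(1)] qlie_class_carrier[OF assms(1), of "frag_of t"] by force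
    then show ?case by (rule generate.incl)
  qed
  then show ?thesis by (simp add: free_qlie_degree_def carrier_subgroup_generated)
qed

lemma lookup_sum_mset_frag_of:
  "Poly_Mapping.lookup (\<Sum>p\<in>#M. frag_of p) q = int (count M q)"
  by (induction M) (auto simp: Poly_Mapping.lookup_add)

context
  fixes H :: "('h, 'm) monoid_scheme" and n :: nat
  assumes H: "comm_group H"
begin

declare One_nat_def [simp del]

private abbreviation (input) "LL \<equiv> free_qlie_degree H (n + 1)"

private abbreviation (input) "PP \<equiv> tensor_group H LL"

private abbreviation (input) "QQ \<equiv> carrier H \<times> rtrees_of_degree H (n + 1)"

private definition theta where
  "theta = free_map PP (\<lambda>p. pure_tensor H LL (fst p) (tree_bracket H (snd p)))"

private definition rooted :: "'h rtree \<Rightarrow> ('h rtree \<Rightarrow>\<^sub>0 int) \<Rightarrow> ('h \<times> 'h rtree \<Rightarrow>\<^sub>0 int)" where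
  "rooted s = frag_extend (\<lambda>t. \<Sum>p\<in>#rootings_in s t. frag_of p)"

private definition ZZ where "ZZ = {x. Poly_Mapping.keys x \<subseteq> QQ \<and> theta x = \<one>\<^bsub>PP\<^esub>}"

private lemma L: "comm_group LL"
  by (rule free_qlie_degree_comm_group[OF H])

private lemma P: "comm_group PP"
  by (rule tensor_group_comm_group[OF H L])

private lemma pure: "(\<lambda>p. pure_tensor H LL (fst p) (tree_bracket H (snd p))) \<in> QQ \<rightarrow> carrier PP"
  using qlie_class_degree[OF H, of "frag_of _" "n + 1"] rtrees_of_degree_subset[of H "n + 1"]
  by (auto intro!: pure_tensor_carrier[OF H L] simp: tree_bracket_class[OF H] subset_iff)

private lemma theta_diff:
  "Poly_Mapping.keys x \<subseteq> QQ \<Longrightarrow> Poly_Mapping.keys y \<subseteq> QQ \<Longrightarrow>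
    theta (x - y) = theta x \<otimes>\<^bsub>PP\<^esub> inv\<^bsub>PP\<^esub> theta y"
  unfolding theta_def by (rule free_map_diff[OF P pure])

private lemma ZZ_diff: "x \<in> ZZ \<Longrightarrow> y \<in> ZZ \<Longrightarrow> x - y \<in> ZZ"
proof -
  interpret comm_group PP by (rule P)
  assume "x \<in> ZZ" "y \<in> ZZ"
  then show ?thesis
    using keys_diff[of x y] by (auto simp: ZZ_def theta_diff)
qed

private lemma ZZ_0: "0 \<in> ZZ"
  using free_map_0[OF P] by (simp add: ZZ_def theta_def)

private lemma ZZ_add: "x \<in> ZZ \<Longrightarrow> y \<in> ZZ \<Longrightarrow> x + y \<in> ZZ"
  using ZZ_diff[of x "0 - y"] ZZ_diff[OF ZZ_0, of y] by simp

private lemma rooted_diff: "rooted s (x - y) = rooted s x - rooted s y"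
  by (simp add: rooted_def frag_extend_diff)

private lemma rooted_add: "rooted s (x + y) = rooted s x + rooted s y"
  by (simp add: rooted_def frag_extend_add)

private lemma rooted_of: "rooted s (frag_of t) = (\<Sum>p\<in>#rootings_in s t. frag_of p)"
  by (simp add: rooted_def)

private lemma rooted_Leaf: "rooted (Leaf h) y = frag_extend (\<lambda>t. frag_of (h, t)) y"
  by (simp add: rooted_def)

private lemma rooted_Node:
  "rooted (Node a b) y =
    rooted a (frag_bracket (frag_of b) y) + rooted b (frag_bracket y (frag_of a))"
  using frag_extend_compose[of "\<lambda>t. \<Sum>p\<in>#rootings_in a t. frag_of p" "\<lambda>t. Node b t" y]
    frag_extend_compose[of "\<lambda>t. \<Sum>p\<in>#rootings_in b t. frag_of p" "\<lambda>t. Node t a" y]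
  by (simp add: rooted_def frag_bracket_def o_def frag_extend_fun_add)

private lemma theta_Leaf:
  assumes h: "h \<in> carrier H" and y: "Poly_Mapping.keys y \<subseteq> rtrees_of_degree H (n + 1)"
  shows "Poly_Mapping.keys (rooted (Leaf h) y) \<subseteq> QQ \<and>
    theta (rooted (Leaf h) y) = pure_tensor H LL h (qlie_class H y)"
proof -
  interpret L: comm_group LL by (rule L)
  interpret P: comm_group PP by (rule P)
  interpret FL: comm_group "free_qlie H" by (rule free_qlie_comm_group[OF H])
  interpret p: group_hom LL PP "pure_tensor H LL h"
    using pure_tensor_hom_right[OF H L h] L.group_axioms P.group_axioms
    by (simp add: group_hom_def group_hom_axioms_def)
  interpret q: group_hom "free_Abelian_group (rtrees H)" "free_qlie H" "qlie_class H"
    by (intro free_group_hom qlie_class_hom H FL.group_axioms)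
  show ?thesis
  proof (rule free_Abelian_group_induct[OF y], goal_cases)
    case 1
    show ?case using p.hom_one q.hom_one free_map_0[OF P]
      by (simp add: rooted_def theta_def free_qlie_degree_def)
  next
    case (2 x y)
    have x: "qlie_class H x \<in> carrier LL" and y: "qlie_class H y \<in> carrier LL"
      using 2 qlie_class_degree[OF H] by auto
    have "qlie_class H (x - y) = qlie_class H x \<otimes>\<^bsub>LL\<^esub> inv\<^bsub>LL\<^esub> qlie_class H y"
      using 2 rtrees_of_degree_subset[of H "n + 1"] y
      by (subst qlie_class_diff[OF H]) (auto simp: free_qlie_degree_def FL.inv_subgroup_generated)
    then show ?case
      using 2 x y p.hom_mult[of "qlie_class H x" "inv\<^bsub>LL\<^esub> qlie_class H y"] p.hom_inv
        keys_diff[of "rooted (Leaf h) x" "rooted (Leaf h) y"]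
      by (simp add: rooted_diff theta_diff) blast
  next
    case (3 t)
    then have t: "(h, t) \<in> QQ" "t \<in> rtrees H" using h rtrees_of_degree_subset[of H "n + 1"] by auto
    have "theta (frag_of (h, t)) = pure_tensor H LL h (tree_bracket H t)"
      using funcset_mem[OF pure t(1)] unfolding theta_def by (subst free_map_of[OF P]) simp_all
    then show ?case using t by (simp add: rooted_Leaf tree_bracket_class[OF H])
  qed
qed

private lemma frag_bracket_degree:
  assumes "Poly_Mapping.keys x \<subseteq> rtrees_of_degree H i" "Poly_Mapping.keys y \<subseteq> rtrees_of_degree H j"
  shows "Poly_Mapping.keys (frag_bracket x y) \<subseteq> rtrees_of_degree H (i + j)"
  using keys_frag_bracket[of x y] assms by (fastforce simp: rtrees_of_degree_def rtrees_def)

private lemma rooted_keys: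
  assumes "s \<in> rtrees_of_degree H i" "Poly_Mapping.keys y \<subseteq> rtrees_of_degree H j" "i + j = n + 2"
  shows "Poly_Mapping.keys (rooted s y) \<subseteq> QQ"
  using assms
proof (induction s arbitrary: i j y)
  case (Leaf h)
  then have "h \<in> carrier H" "j = n + 1" by (auto simp: rtrees_of_degree_def rtrees_def)
  then show ?case using theta_Leaf[of h y] Leaf.prems(2) by blast
next
  case (Node a b)
  then obtain k l where kl: "a \<in> rtrees_of_degree H k" "b \<in> rtrees_of_degree H l" "i = k + l"
    by (auto simp: rtrees_of_degree_def rtrees_def)
  have "Poly_Mapping.keys (frag_bracket (frag_of b) y) \<subseteq> rtrees_of_degree H (l + j)"
    "Poly_Mapping.keys (frag_bracket y (frag_of a)) \<subseteq> rtrees_of_degree H (j + k)"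
    using Node.prems kl by (intro frag_bracket_degree; simp)+
  then have "Poly_Mapping.keys (rooted a (frag_bracket (frag_of b) y)) \<subseteq> QQ"
    "Poly_Mapping.keys (rooted b (frag_bracket y (frag_of a))) \<subseteq> QQ"
    using Node.IH(1)[OF kl(1)] Node.IH(2)[OF kl(2)] Node.prems(3) kl(3) by simp_all
  then show ?case unfolding rooted_Node by (intro order_trans[OF keys_add] Un_least)
qed

private lemma rooted_ideal:
  assumes "s \<in> rtrees_of_degree H i" "Poly_Mapping.keys y \<subseteq> rtrees_of_degree H j" "i + j = n + 2"
    and "y \<in> qlie_ideal H"
  shows "rooted s y \<in> ZZ"
  using assms
proof (induction s arbitrary: i j y)
  case (Leaf h)
  interpret L: comm_group LL by (rule L)
  interpret P: comm_group PP by (rule P)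
  have h: "h \<in> carrier H" "j = n + 1" using Leaf by (auto simp: rtrees_of_degree_def rtrees_def)
  interpret p: group_hom LL PP "pure_tensor H LL h"
    using pure_tensor_hom_right[OF H L h(1)] L.group_axioms P.group_axioms
    by (simp add: group_hom_def group_hom_axioms_def)
  have "qlie_class H y = qlie_class H 0" using Leaf by (simp add: qlie_class_eq)
  also have "\<dots> = \<one>\<^bsub>LL\<^esub>"
    using mem_qlie_class[of _ H 0] by (auto simp: free_qlie_degree_def free_qlie_def)
  finally show ?case using theta_Leaf[of h y] h Leaf p.hom_one by (simp add: ZZ_def)
next
  case (Node a b)
  then obtain k l where kl: "a \<in> rtrees_of_degree H k" "b \<in> rtrees_of_degree H l" "i = k + l"
    by (auto simp: rtrees_of_degree_def rtrees_def)
  have k: "Poly_Mapping.keys (frag_bracket (frag_of b) y) \<subseteq> rtrees_of_degree H (l + j)"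
    "Poly_Mapping.keys (frag_bracket y (frag_of a)) \<subseteq> rtrees_of_degree H (j + k)"
    using Node.prems kl by (intro frag_bracket_degree; simp)+
  have "a \<in> rtrees H" "b \<in> rtrees H" using kl by (auto simp: rtrees_of_degree_def)
  then have "frag_bracket (frag_of b) y \<in> qlie_ideal H" "frag_bracket y (frag_of a) \<in> qlie_ideal H"
    using Node.prems(4) by (auto intro: qlie_ideal.left qlie_ideal.right)
  then show ?case unfolding rooted_Node
    using Node.IH(1)[OF kl(1) k(1)] Node.IH(2)[OF kl(2) k(2)] Node.prems(3) kl(3)
    by (intro ZZ_add) simp_all
qed

private definition rooted_all :: "'h utree \<Rightarrow> ('h \<times> 'h rtree \<Rightarrow>\<^sub>0 int)" where
  "rooted_all T = (\<Sum>p\<in>#rootings T. frag_of p)"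

private lemma rooted_all_glue:
  "rooted_all (glue s t) = rooted s (frag_of t) + rooted t (frag_of s)"
  by (simp add: rooted_all_def rootings_glue rooted_of)

private lemma glue_trees:
  assumes "glue s t \<in> trees H n"
  obtains i j where "s \<in> rtrees_of_degree H i" "t \<in> rtrees_of_degree H j" "i + j = n + 2"
  using assms
  by (auto simp: trees_def labels_glue trivalent_glue rtrees_of_degree_def rtrees_def size_rtree_labels)

private lemma rooted_all_keys:
  assumes "T \<in> trees H n"
  shows "Poly_Mapping.keys (rooted_all T) \<subseteq> QQ"
proof -
  obtain s t where T: "T = glue s t" by (rule utree_cases)
  with assms obtain i j where ij:
    "s \<in> rtrees_of_degree H i" "t \<in> rtrees_of_degree H j" "i + j = n + 2"
    using glue_trees by blast
  have "Poly_Mapping.keys (rooted s (frag_of t)) \<subseteq> QQ" "Poly_Mapping.keys (rooted t (frag_of s)) \<subseteq> QQ"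
    using rooted_keys[OF ij(1) _ ij(3), of "frag_of t"] rooted_keys[OF ij(2), of "frag_of s" i] ij
    by (simp_all add: add.commute)
  then show ?thesis unfolding T rooted_all_glue by (intro order_trans[OF keys_add] Un_least)
qed

private lemma eta_tree_theta: "eta_tree H n T = theta (rooted_all T)"
proof -
  have "Poly_Mapping.keys (rooted_all T) = set_mset (rootings T)"
    by (auto simp: rooted_all_def in_keys_iff lookup_sum_mset_frag_of)
  then show ?thesis
    by (simp add: eta_tree_def theta_def free_map_def int_pow_int rooted_all_def lookup_sum_mset_frag_of)
qed

private lemma eta_tree_carrier: "eta_tree H n \<in> trees H n \<rightarrow> carrier PP"
proof
  fix T assume "T \<in> trees H n"
  then show "eta_tree H n T \<in> carrier PP"
    using hom_in_carrier[OF free_map_hom[OF P pure], of "rooted_all T"] rooted_all_keys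
    by (simp add: eta_tree_theta theta_def)
qed

private lemma free_map_eta_tree:
  assumes "Poly_Mapping.keys r \<subseteq> trees H n"
  shows "Poly_Mapping.keys (frag_extend rooted_all r) \<subseteq> QQ \<and>
    free_map PP (eta_tree H n) r = theta (frag_extend rooted_all r)"
proof (rule free_Abelian_group_induct[OF assms], goal_cases)
  case 1
  show ?case by (simp add: theta_def free_map_0[OF P])
next
  case (2 x y)
  then show ?case
    using keys_diff[of "frag_extend rooted_all x" "frag_extend rooted_all y"]
    by (auto simp: free_map_diff[OF P eta_tree_carrier] frag_extend_diff theta_diff)
next
  case (3 T)
  then show ?case
    using eta_tree_carrier rooted_all_keys[OF 3]
    by (simp add: free_map_of[OF P] Pi_iff eta_tree_theta)
qed

private lemma antisym_ideal:
  "s \<in> rtrees H \<Longrightarrow> t \<in> rtrees H \<Longrightarrow> frag_of (Node s t) + frag_of (Node t s) \<in> qlie_ideal H"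
  using qlie_ideal.antisym[of "frag_of s" H "frag_of t"] by simp

private lemma jacobi_ideal:
  assumes "s \<in> rtrees H" "t \<in> rtrees H" "u \<in> rtrees H"
  shows "frag_of (Node (Node s t) u) + frag_of (Node (Node t u) s) + frag_of (Node (Node u s) t)
    \<in> qlie_ideal H"
  using qlie_ideal.jacobi[of "frag_of s" H "frag_of t" "frag_of u"] assms by simp

private lemma jacobi_ideal':
  assumes "x \<in> rtrees H" "y \<in> rtrees H" "z \<in> rtrees H"
  shows "frag_of (Node x (Node y z)) + frag_of (Node z (Node x y)) + frag_of (Node (Node x z) y)
    \<in> qlie_ideal H"
proof -
  let ?f = "\<lambda>s. frag_of s :: 'h rtree \<Rightarrow>\<^sub>0 int"
  have flip: "?f (Node x (Node y z)) - ?f (Node (Node z y) x) \<in> qlie_ideal H"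
    if "x \<in> rtrees H" "y \<in> rtrees H" "z \<in> rtrees H" for x y z
  proof -
    have "frag_bracket (?f x) (?f (Node y z) + ?f (Node z y)) \<in> qlie_ideal H"
      using that by (intro qlie_ideal.left antisym_ideal) auto
    moreover have "Node z y \<in> rtrees H" using that by (auto simp: rtrees_def)
    then have "?f (Node x (Node z y)) + ?f (Node (Node z y) x) \<in> qlie_ideal H"
      using that by (intro antisym_ideal) auto
    ultimately have "frag_bracket (?f x) (?f (Node y z) + ?f (Node z y)) -
        (?f (Node x (Node z y)) + ?f (Node (Node z y) x)) \<in> qlie_ideal H"
      by (rule qlie_ideal.diff)
    then show ?thesis by (simp add: frag_bracket_add_right algebra_simps)
  qed
  have "(?f (Node x (Node y z)) - ?f (Node (Node z y) x)) +
      (?f (Node z (Node x y)) - ?f (Node (Node y x) z)) +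
      (?f (Node (Node x z) y) + ?f (Node (Node z y) x) + ?f (Node (Node y x) z)) \<in> qlie_ideal H"
    using assms by (intro qlie_ideal_add flip jacobi_ideal)
  then show ?thesis by (simp add: algebra_simps)
qed

private lemma rooted_ideal_sum:
  assumes "s \<in> rtrees_of_degree H i" "i + j = n + 2"
    and "frag_of t + frag_of u \<in> qlie_ideal H"
    and "t \<in> rtrees_of_degree H j" "u \<in> rtrees_of_degree H j"
  shows "rooted s (frag_of t) + rooted s (frag_of u) \<in> ZZ"
proof -
  have "rooted s (frag_of t + frag_of u) \<in> ZZ"
    by (rule rooted_ideal[OF assms(1) _ assms(2,3)])
      (use assms keys_add[of "frag_of t" "frag_of u"] in auto)
  then show ?thesis by (simp add: rooted_add)
qed

private lemma rooted_ideal_sum3: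
  assumes "s \<in> rtrees_of_degree H i" "i + j = n + 2"
    and "frag_of t + frag_of u + frag_of v \<in> qlie_ideal H"
    and "t \<in> rtrees_of_degree H j" "u \<in> rtrees_of_degree H j" "v \<in> rtrees_of_degree H j"
  shows "rooted s (frag_of t) + rooted s (frag_of u) + rooted s (frag_of v) \<in> ZZ"
proof -
  have "rooted s (frag_of t + frag_of u + frag_of v) \<in> ZZ"
    by (rule rooted_ideal[OF assms(1) _ assms(2,3)])
      (use assms in \<open>auto dest!: subsetD[OF keys_add]\<close>)
  then show ?thesis by (simp add: rooted_add)
qed

private lemma rels_as:
  assumes "glue (Node a b) c \<in> trees H n"
  shows "frag_extend rooted_all (frag_of (glue (Node a b) c) + frag_of (glue (Node b a) c)) \<in> ZZ"
proof -
  define i j k where "i = size (rtree_labels a)" "j = size (rtree_labels b)" "k = size (rtree_labels c)"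
  then have d: "a \<in> rtrees_of_degree H i" "b \<in> rtrees_of_degree H j" "c \<in> rtrees_of_degree H k"
    and s: "i + j + k = n + 2"
    using assms by (auto simp: trees_def labels_glue trivalent_glue rtrees_of_degree_def rtrees_def
        size_rtree_labels)
  have N: "Node s t \<in> rtrees_of_degree H m"
    if "s \<in> rtrees_of_degree H p" "t \<in> rtrees_of_degree H q" "m = p + q" for s t p q m
    using that by (auto simp: rtrees_of_degree_def rtrees_def)
  have r: "a \<in> rtrees H" "b \<in> rtrees H" "c \<in> rtrees H" using d by (auto simp: rtrees_of_degree_def)
  have "rooted a (frag_of (Node b c)) + rooted a (frag_of (Node c b)) \<in> ZZ"
    by (rule rooted_ideal_sum[OF d(1), of "j + k"]) (use s d r in \<open>auto intro: N antisym_ideal\<close>)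
  moreover have "rooted b (frag_of (Node c a)) + rooted b (frag_of (Node a c)) \<in> ZZ"
    by (rule rooted_ideal_sum[OF d(2), of "i + k"]) (use s d r in \<open>auto intro: N antisym_ideal\<close>)
  moreover have "rooted c (frag_of (Node a b)) + rooted c (frag_of (Node b a)) \<in> ZZ"
    by (rule rooted_ideal_sum[OF d(3), of "i + j"]) (use s d r in \<open>auto intro: N antisym_ideal\<close>)
  ultimately have "(rooted a (frag_of (Node b c)) + rooted a (frag_of (Node c b))) +
     (rooted b (frag_of (Node c a)) + rooted b (frag_of (Node a c))) +
     (rooted c (frag_of (Node a b)) + rooted c (frag_of (Node b a))) \<in> ZZ" by (simp only: ZZ_add)
  then show ?thesis
    by (simp add: frag_extend_add rooted_all_glue rooted_Node algebra_simps)
qed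

private lemma rels_ihx:
  assumes "ihx_tree a b c d \<in> trees H n"
  shows "frag_extend rooted_all
    (frag_of (ihx_tree a b c d) + frag_of (ihx_tree b c a d) + frag_of (ihx_tree c a b d)) \<in> ZZ"
proof -
  define i j k l where "i = size (rtree_labels a)" "j = size (rtree_labels b)"
    "k = size (rtree_labels c)" "l = size (rtree_labels d)"
  then have d: "a \<in> rtrees_of_degree H i" "b \<in> rtrees_of_degree H j" "c \<in> rtrees_of_degree H k"
      "d \<in> rtrees_of_degree H l"
    and s: "i + j + k + l = n + 2"
    using assms by (auto simp: trees_def ihx_tree_def labels_glue trivalent_glue rtrees_of_degree_def
        rtrees_def size_rtree_labels)
  have N: "Node s (Node t u) \<in> rtrees_of_degree H m" "Node (Node s t) u \<in> rtrees_of_degree H m"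
    if "s \<in> rtrees_of_degree H p" "t \<in> rtrees_of_degree H q" "u \<in> rtrees_of_degree H r"
      "m = p + q + r" for s t u p q r m
    using that by (auto simp: rtrees_of_degree_def rtrees_def)
  have r: "a \<in> rtrees H" "b \<in> rtrees H" "c \<in> rtrees H" "d \<in> rtrees H"
    using d by (auto simp: rtrees_of_degree_def)
  have "rooted a (frag_of (Node b (Node c d))) + rooted a (frag_of (Node d (Node b c)))
      + rooted a (frag_of (Node (Node b d) c)) \<in> ZZ"
    by (rule rooted_ideal_sum3[OF d(1), of "j + k + l"]) (use s d r in \<open>auto intro: N jacobi_ideal'\<close>)
  moreover have "rooted b (frag_of (Node c (Node a d))) + rooted b (frag_of (Node d (Node c a)))
      + rooted b (frag_of (Node (Node c d) a)) \<in> ZZ"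
    by (rule rooted_ideal_sum3[OF d(2), of "i + k + l"]) (use s d r in \<open>auto intro: N jacobi_ideal'\<close>)
  moreover have "rooted c (frag_of (Node a (Node b d))) + rooted c (frag_of (Node d (Node a b)))
      + rooted c (frag_of (Node (Node a d) b)) \<in> ZZ"
    by (rule rooted_ideal_sum3[OF d(3), of "i + j + l"]) (use s d r in \<open>auto intro: N jacobi_ideal'\<close>)
  moreover have "rooted d (frag_of (Node (Node a b) c)) + rooted d (frag_of (Node (Node b c) a))
      + rooted d (frag_of (Node (Node c a) b)) \<in> ZZ"
    by (rule rooted_ideal_sum3[OF d(4), of "i + j + k"]) (use s d r in \<open>auto intro: N jacobi_ideal\<close>)
  ultimately have "(rooted a (frag_of (Node b (Node c d))) + rooted a (frag_of (Node d (Node b c)))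
      + rooted a (frag_of (Node (Node b d) c))) +
     (rooted b (frag_of (Node c (Node a d))) + rooted b (frag_of (Node d (Node c a)))
      + rooted b (frag_of (Node (Node c d) a))) +
     (rooted c (frag_of (Node a (Node b d))) + rooted c (frag_of (Node d (Node a b)))
      + rooted c (frag_of (Node (Node a d) b))) +
     (rooted d (frag_of (Node (Node a b) c)) + rooted d (frag_of (Node (Node b c) a))
      + rooted d (frag_of (Node (Node c a) b))) \<in> ZZ" by (simp only: ZZ_add)
  then show ?thesis
    by (simp add: frag_extend_add ihx_tree_def rooted_all_glue rooted_Node algebra_simps)
qed

private lemma rels_linear:
  assumes h: "h \<in> carrier H" "k \<in> carrier H" and T: "glue (Leaf (h \<otimes>\<^bsub>H\<^esub> k)) t \<in> trees H n"
  shows "frag_extend rooted_all (frag_of (glue (Leaf (h \<otimes>\<^bsub>H\<^esub> k)) t) -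
    frag_of (glue (Leaf h) t) - frag_of (glue (Leaf k) t)) \<in> ZZ"
proof -
  interpret H: comm_group H by (rule H)
  interpret P: comm_group PP by (rule P)
  have t: "t \<in> rtrees_of_degree H (n + 1)"
    using T by (auto simp: trees_def labels_glue trivalent_glue rtrees_of_degree_def rtrees_def
        size_rtree_labels)
  let ?x = "frag_of (Leaf (h \<otimes>\<^bsub>H\<^esub> k)) - frag_of (Leaf h) - frag_of (Leaf k)"
  have "rooted t ?x \<in> ZZ"
  proof (rule rooted_ideal[OF t, of _ 1])
    show "Poly_Mapping.keys ?x \<subseteq> rtrees_of_degree H 1"
      using h by (auto dest!: subsetD[OF keys_diff] simp: rtrees_of_degree_def rtrees_def)
    show "?x \<in> qlie_ideal H" by (rule qlie_ideal.linear[OF h])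
  qed simp
  moreover let ?y = "frag_of (h \<otimes>\<^bsub>H\<^esub> k, t) - frag_of (h, t) - frag_of (k, t)"
  have "?y \<in> ZZ"
  proof -
    have k: "Poly_Mapping.keys (frag_of (h \<otimes>\<^bsub>H\<^esub> k, t) - frag_of (h, t)) \<subseteq> QQ"
      "Poly_Mapping.keys ?y \<subseteq> QQ"
      using h t by (auto dest!: subsetD[OF keys_diff])
    have br: "tree_bracket H t \<in> carrier LL"
      using t rtrees_of_degree_subset[of H "n + 1"] qlie_class_degree[OF H, of "frag_of t" "n + 1"]
      by (auto simp: tree_bracket_class[OF H])
    have of: "theta (frag_of (g, t)) = pure_tensor H LL g (tree_bracket H t)" if "g \<in> carrier H" for g
      using pure_tensor_carrier[OF H L that br] by (simp add: theta_def free_map_of[OF P])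
    note c = pure_tensor_carrier[OF H L h(1) br] pure_tensor_carrier[OF H L h(2) br]
    have "theta ?y = \<one>\<^bsub>PP\<^esub>"
      using k h t c hom_mult[OF pure_tensor_hom_left[OF H L br] h]
      by (simp add: theta_diff of P.m_comm[OF c] P.m_assoc)
    with k show ?thesis by (simp add: ZZ_def)
  qed
  ultimately have "?y + rooted t ?x \<in> ZZ" by (intro ZZ_add)
  then show ?thesis
    by (simp add: frag_extend_diff frag_extend_add rooted_all_glue rooted_Leaf rooted_diff
        rooted_add algebra_simps)
qed

private lemma eta_tree_rels: "r \<in> tree_rels H n \<Longrightarrow> free_map PP (eta_tree H n) r = \<one>\<^bsub>PP\<^esub>"
proof -
  assume r: "r \<in> tree_rels H n"
  then have "r \<in> carrier (free_Abelian_group (trees H n))" using tree_rels_carrier by blast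
  then have "free_map PP (eta_tree H n) r = theta (frag_extend rooted_all r)"
    using free_map_eta_tree by simp
  moreover have "frag_extend rooted_all r \<in> ZZ"
    using r unfolding tree_rels_def as_rels_def ihx_rels_def linear_rels_def
    by (auto simp: rels_as rels_ihx rels_linear)
  ultimately show ?thesis by (simp add: ZZ_def)
qed

lemma eta_hom: "eta H n \<in> hom (tree_group H n) (tensor_group H (free_qlie_degree H (n + 1)))"
  unfolding eta_def tree_group_def
  by (rule presented_map_hom[OF P eta_tree_carrier tree_rels_carrier eta_tree_rels])

lemma eta_class:
  "T \<in> trees H n \<Longrightarrow> eta H n (presented_class (trees H n) (tree_rels H n) T) = eta_tree H n T"
  unfolding eta_def
  by (rule presented_map_class[OF P eta_tree_carrier tree_rels_carrier eta_tree_rels])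

end

end

theory Submission
  imports Defs "HOL-Algebra.Multiplicative_Group"
begin

text \<open>
  Fix \<open>i\<close>. A pair of a label \<open>h\<close> and a rooted tree \<open>t\<close> can be turned into an unrooted tree by
  attaching a univalent vertex with label \<open>\<alpha> i\<close> at the root of \<open>t\<close>; weight the result by the
  \<open>i\<close>-th coordinate of \<open>h\<close>. This induces a homomorphism \<open>c\<^sub>i\<close> (\<open>contraction\<close>) from
  \<open>H \<otimes> L'\<^sub>n\<^sub>+\<^sub>1(H)\<close> to the tree group. Applied to \<open>\<eta>'(T)\<close> it picks out the univalent vertices of
  \<open>T\<close> with label \<open>\<alpha> i\<close>, makes each of them a root, and then puts the label \<open>\<alpha> i\<close> back, which
  returns \<open>T\<close> every time. Hence \<open>c\<^sub>i \<circ> \<eta>'\<close> is multiplication by \<open>\<omega> i\<close> on the part of signature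
  \<open>\<omega>\<close> (\<open>contraction_eta\<close>), and so \<open>\<omega> i\<close> kills the kernel of \<open>\<eta>'\<close>. As this holds for every \<open>i\<close>,
  the greatest common divisor kills the kernel.

  The point that needs an argument is that \<open>c\<^sub>i\<close> is defined on the free quasi-Lie algebra, and
  with values in the group of the single signature \<open>\<omega>\<close>. For this, all labels
  are expanded in the basis (\<open>leaf_extend\<close>), and gluing two rooted trees at their roots is
  extended to a bilinear pairing into the trees of signature \<open>\<omega>\<close>, where trees of other
  signatures count as zero (\<open>glue_pairing\<close>). This pairing is symmetric, because the two sides of
  the distinguished edge can be exchanged, and invariant, because that edge can be moved across
  a vertex: \<open>\<langle>[x, y], z\<rangle> = \<langle>x, [y, z]\<rangle>\<close>. The radical of an
  invariant symmetric pairing is a two-sided ideal; antisymmetry and IHX put the defining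
  relations of the quasi-Lie algebra into it (\<open>qlie_ideal_radical\<close>).
\<close>

section \<open>Generators, relations and powers\<close>

lemma frag_induct [case_names zero diff of]:
  assumes "P 0" "\<And>x y. P x \<Longrightarrow> P y \<Longrightarrow> P (x - y)" "\<And>s. P (frag_of s)"
  shows "P x"
  using free_Abelian_group_induct[OF subset_UNIV, where P = P and x = x] assms by blast

lemma presented_group_cases:
  assumes "X \<in> carrier (presented_group S R)"
  obtains x where "Poly_Mapping.keys x \<subseteq> S"
    "X = generate (free_Abelian_group S) R #>\<^bsub>free_Abelian_group S\<^esub> x"
  using assms by (auto simp: presented_group_def carrier_FactGroup)

lemma hom_diff_free:
  assumes "group G" "f \<in> hom (free_Abelian_group S) G"
    and "Poly_Mapping.keys x \<subseteq> S" "Poly_Mapping.keys y \<subseteq> S"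
  shows "f (x - y) = f x \<otimes>\<^bsub>G\<^esub> inv\<^bsub>G\<^esub> f y"
proof -
  interpret group_hom "free_Abelian_group S" G f by (rule free_group_hom[OF assms(1,2)])
  show ?thesis using hom_mult[of x "- y"] hom_inv[of y] assms by simp
qed

lemma hom_eq_on_presented_classes:
  assumes R: "R \<subseteq> carrier (free_Abelian_group S)" and G: "group G"
    and f: "f \<in> hom (presented_group S R) G" and g: "g \<in> hom (presented_group S R) G"
    and eq: "\<And>s. s \<in> S \<Longrightarrow> f (presented_class S R s) = g (presented_class S R s)"
    and X: "X \<in> carrier (presented_group S R)"
  shows "f X = g X"
proof -
  let ?p = "\<lambda>x. generate (free_Abelian_group S) R #>\<^bsub>free_Abelian_group S\<^esub> x"
  interpret G: group G by (rule G)
  note p = presented_proj_hom[OF R]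
  have fp: "f \<circ> ?p \<in> hom (free_Abelian_group S) G" and gp: "g \<circ> ?p \<in> hom (free_Abelian_group S) G"
    using hom_compose[OF p f] hom_compose[OF p g] by auto
  obtain x where x: "Poly_Mapping.keys x \<subseteq> S" "X = ?p x" using X by (rule presented_group_cases)
  have "(f \<circ> ?p) x = (g \<circ> ?p) x"
  proof (rule free_Abelian_group_induct[OF x(1)], goal_cases)
    case 1
    show ?case using hom_one[OF fp] hom_one[OF gp] by simp
  next
    case (2 x y)
    then show ?case using hom_diff_free[OF G fp] hom_diff_free[OF G gp] by simp
  next
    case (3 s)
    then show ?case using eq by (simp add: presented_class_def)
  qed
  then show ?thesis by (simp add: x(2))
qed

lemma hom_finprod:
  assumes "comm_group G" "comm_group K" "h \<in> hom G K" "finite A" "f \<in> A \<rightarrow> carrier G"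
  shows "h (finprod G f A) = (\<Otimes>\<^bsub>K\<^esub>a\<in>A. h (f a))"
proof -
  interpret G: comm_group G by fact
  interpret K: comm_group K by fact
  interpret group_hom G K h by unfold_locales (rule assms(3))
  show ?thesis using assms(4,5) by induction (auto simp: Pi_iff)
qed

lemma (in comm_group) finprod_pow_indicator:
  assumes "finite A" "g \<in> carrier G"
  shows "(\<Otimes>p\<in>A. (if Q p then g else \<one>) [^] (c p :: nat)) = g [^] (\<Sum>p\<in>{p\<in>A. Q p}. c p)"
  using assms(1)
proof induction
  case (insert a A)
  have "{p \<in> insert a A. Q p} = (if Q a then insert a {p \<in> A. Q p} else {p \<in> A. Q p})" by auto
  with insert assms(2) show ?case by (auto simp: nat_pow_mult)
qed simp

lemma (in group) pow_Gcd_eq_one: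
  assumes "x \<in> carrier G" "\<And>k. k \<in> K \<Longrightarrow> x [^] (k :: nat) = \<one>"
  shows "x [^] Gcd K = \<one>"
  using assms by (auto simp: pow_eq_id intro!: Gcd_greatest)


section \<open>Expanding labels\<close>

text \<open>
  A map from labels to elements of a free nonassociative ring extends to a ring homomorphism on
  the free nonassociative ring on the labels; \<open>leaf_extend f\<close> is its restriction to trees.
\<close>

primrec leaf_extend :: "('h \<Rightarrow> ('k rtree \<Rightarrow>\<^sub>0 int)) \<Rightarrow> 'h rtree \<Rightarrow> ('k rtree \<Rightarrow>\<^sub>0 int)" where
  "leaf_extend f (Leaf h) = f h"
| "leaf_extend f (Node s t) = frag_bracket (leaf_extend f s) (leaf_extend f t)"

lemma frag_bracket_0 [simp]: "frag_bracket 0 y = 0" "frag_bracket x 0 = 0"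
  using frag_bracket_diff_left[of 0 0 y] frag_bracket_diff_right[of x 0 0] by simp_all

lemma frag_extend_leaf_extend_bracket:
  "frag_extend (leaf_extend f) (frag_bracket x y) =
    frag_bracket (frag_extend (leaf_extend f) x) (frag_extend (leaf_extend f) y)"
proof (induction x rule: frag_induct)
  case (of s)
  show ?case
    by (induction y rule: frag_induct) (simp_all add: frag_bracket_diff_right frag_extend_diff)
qed (simp_all add: frag_bracket_diff_left frag_extend_diff)

lemma leaf_extend_of:
  "(\<And>h. h \<in># rtree_labels t \<Longrightarrow> f h = frag_of (Leaf h)) \<Longrightarrow> leaf_extend f t = frag_of t"
  by (induction t) auto


section \<open>The gluing pairing\<close>

definition glue_pairing ::
    "'h utree set \<Rightarrow> ('h rtree \<Rightarrow>\<^sub>0 int) \<Rightarrow> ('h rtree \<Rightarrow>\<^sub>0 int) \<Rightarrow> ('h utree \<Rightarrow>\<^sub>0 int)"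
  where "glue_pairing S x y =
    frag_extend (\<lambda>s. frag_extend (\<lambda>t. if glue s t \<in> S then frag_of (glue s t) else 0) y) x"

lemma glue_pairing_of [simp]:
  "glue_pairing S (frag_of s) (frag_of t) = (if glue s t \<in> S then frag_of (glue s t) else 0)"
  by (simp add: glue_pairing_def)

lemma glue_pairing_diff_left: "glue_pairing S (x - x') y = glue_pairing S x y - glue_pairing S x' y"
  by (simp add: glue_pairing_def frag_extend_diff)

lemma glue_pairing_diff_right: "glue_pairing S x (y - y') = glue_pairing S x y - glue_pairing S x y'"
  by (simp add: glue_pairing_def frag_extend_diff frag_extend_fun_diff)

lemma glue_pairing_0 [simp]: "glue_pairing S 0 y = 0" "glue_pairing S x 0 = 0"
  using glue_pairing_diff_left[of S 0 0 y] glue_pairing_diff_right[of S x 0 0] by simp_all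

lemma glue_pairing_add_left: "glue_pairing S (x + x') y = glue_pairing S x y + glue_pairing S x' y"
  by (simp add: glue_pairing_def frag_extend_add)

lemma glue_pairing_add_right: "glue_pairing S x (y + y') = glue_pairing S x y + glue_pairing S x y'"
  by (simp add: glue_pairing_def frag_extend_add frag_extend_fun_add)

lemma glue_pairing_keys: "Poly_Mapping.keys (glue_pairing S x y) \<subseteq> S"
  unfolding glue_pairing_def
  by (auto dest!: subsetD[OF keys_frag_extend] split: if_splits)

lemma glue_pairing_commute: "glue_pairing S x y = glue_pairing S y x"
proof (induction x rule: frag_induct)
  case (of s)
  show ?case
    by (induction y rule: frag_induct)
      (simp_all add: glue_pairing_diff_left glue_pairing_diff_right glue_commute)
qed (simp_all add: glue_pairing_diff_left glue_pairing_diff_right)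

text \<open>The trilinear form \<open>\<langle>[x, y], z\<rangle>\<close> is the tripod with \<open>x\<close>, \<open>y\<close>, \<open>z\<close> as its branches.\<close>

lemma glue_pairing_invariant:
  "glue_pairing S (frag_bracket x y) z = glue_pairing S x (frag_bracket y z)"
proof (induction x rule: frag_induct)
  case (of s)
  show ?case
  proof (induction y rule: frag_induct)
    case (of t)
    show ?case
      by (induction z rule: frag_induct)
        (simp_all add: glue_pairing_diff_right frag_bracket_diff_right glue_across)
  qed (simp_all add: glue_pairing_diff_left glue_pairing_diff_right
      frag_bracket_diff_left frag_bracket_diff_right)
qed (simp_all add: glue_pairing_diff_left frag_bracket_diff_left)

lemma glue_pairing_rotate:
  "glue_pairing S (frag_bracket x y) z = glue_pairing S y (frag_bracket z x)"
  by (metis glue_pairing_commute glue_pairing_invariant)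

text \<open>
  The pairing forgets the trees outside \<open>S\<close>. The closure conditions on \<open>S\<close> make this compatible
  with the relations: the trees of one relation are either all kept or all forgotten. Working
  modulo any subgroup \<open>N\<close> that contains the relations leaves the target of the pairing implicit.
\<close>

locale tree_relations =
  fixes S :: "'h utree set" and N :: "('h utree \<Rightarrow>\<^sub>0 int) set"
  assumes zero_mem: "0 \<in> N" and diff_mem: "x \<in> N \<Longrightarrow> y \<in> N \<Longrightarrow> x - y \<in> N"
    and as: "as_rels S \<subseteq> N" and ihx: "ihx_rels S \<subseteq> N"
    and S_as: "glue (Node a b) c \<in> S \<Longrightarrow> glue (Node b a) c \<in> S"
    and S_ihx: "ihx_tree A B C D \<in> S \<Longrightarrow> ihx_tree B C A D \<in> S"
begin

lemma glue_pairing_antisym: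
  "glue_pairing S (frag_bracket x y + frag_bracket y x) z \<in> N"
proof (induction x rule: frag_induct)
  case zero
  show ?case by (simp add: zero_mem)
next
  case (diff x x')
  from diff_mem[OF this] show ?case
    by (simp add: glue_pairing_diff_left glue_pairing_add_left frag_bracket_diff_left
        frag_bracket_diff_right algebra_simps)
next
  case (of s)
  show ?case
  proof (induction y rule: frag_induct)
    case zero
    show ?case by (simp add: zero_mem)
  next
    case (diff y y')
    from diff_mem[OF this] show ?case
      by (simp add: glue_pairing_diff_left glue_pairing_add_left frag_bracket_diff_left
          frag_bracket_diff_right algebra_simps)
  next
    case (of t)
    show ?case
    proof (induction z rule: frag_induct)
      case zero
      show ?case by (simp add: zero_mem)
    next
      case (diff z z')
      from diff_mem[OF this] show ?case by (simp add: glue_pairing_diff_right)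
    next
      case (of u)
      show ?case
      proof (cases "glue (Node s t) u \<in> S")
        case True
        then have "frag_of (glue (Node s t) u) + frag_of (glue (Node t s) u) \<in> as_rels S"
          unfolding as_rels_def by blast
        with True as S_as[OF True] show ?thesis by (auto simp: glue_pairing_add_left)
      next
        case False
        with S_as[of t s u] have "glue (Node t s) u \<notin> S" by blast
        with False show ?thesis by (simp add: glue_pairing_add_left zero_mem)
      qed
    qed
  qed
qed

text \<open>
  By multilinearity \<open>x\<close>, \<open>y\<close>, \<open>z\<close>, \<open>w\<close> are trees. Then \<open>\<langle>[[x, y], z], w\<rangle> = \<langle>[x, y], [z, w]\<rangle>\<close> is the
  tree in IHX whose inner edge separates \<open>x\<close>, \<open>y\<close> from \<open>z\<close>, \<open>w\<close>, so the three Jacobi terms become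
  the three terms of IHX.
\<close>

lemma glue_pairing_jacobi:
  "glue_pairing S (frag_bracket (frag_bracket x y) z + frag_bracket (frag_bracket y z) x +
    frag_bracket (frag_bracket z x) y) w \<in> N" (is "?P x y z w")
proof -
  note lin = glue_pairing_diff_left glue_pairing_diff_right glue_pairing_add_left
    frag_bracket_diff_left frag_bracket_diff_right
  have tree: "glue (Node (Node a b) c) e = ihx_tree a b c e" for a b c e
    by (simp add: ihx_tree_def glue_across)
  have of: "?P (frag_of a) (frag_of b) (frag_of c) (frag_of e)" for a b c e
  proof -
    have cyc: "ihx_tree b c a e \<in> S \<longleftrightarrow> ihx_tree a b c e \<in> S"
      "ihx_tree c a b e \<in> S \<longleftrightarrow> ihx_tree a b c e \<in> S"
      using S_ihx by blast+
    show ?thesis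
    proof (cases "ihx_tree a b c e \<in> S")
      case True
      then have "frag_of (ihx_tree a b c e) + frag_of (ihx_tree b c a e) +
          frag_of (ihx_tree c a b e) \<in> ihx_rels S"
        unfolding ihx_rels_def by blast
      with True cyc ihx show ?thesis
        by (auto simp: glue_pairing_add_left tree)
    next
      case False
      with cyc show ?thesis
        by (simp add: glue_pairing_add_left tree zero_mem)
    qed
  qed
  have w: "?P (frag_of a) (frag_of b) (frag_of c) w" for a b c
  proof (induction w rule: frag_induct)
    case (diff w w')
    from diff_mem[OF this] show ?case by (simp add: glue_pairing_diff_right)
  qed (simp_all only: of, simp add: zero_mem)
  have z: "?P (frag_of a) (frag_of b) z w" for a b
  proof (induction z rule: frag_induct)
    case (diff z z')
    from diff_mem[OF this] show ?case by (simp add: lin algebra_simps)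
  qed (simp_all only: w, simp add: zero_mem)
  have y: "?P (frag_of a) y z w" for a
  proof (induction y rule: frag_induct)
    case (diff y y')
    from diff_mem[OF this] show ?case by (simp add: lin algebra_simps)
  qed (simp_all only: z, simp add: zero_mem)
  show ?thesis
  proof (induction x rule: frag_induct)
    case (diff x x')
    from diff_mem[OF this] show ?case by (simp add: lin algebra_simps)
  qed (simp_all only: y, simp add: zero_mem)
qed

text \<open>
  The radical of the pairing absorbs brackets because \<open>\<langle>[x, y], z\<rangle>\<close> can be rewritten, by
  invariance, as a pairing of either factor alone with something else.
\<close>

lemma qlie_ideal_radical:
  assumes f: "\<And>h k. h \<in> carrier H \<Longrightarrow> k \<in> carrier H \<Longrightarrow> f (h \<otimes>\<^bsub>H\<^esub> k) = f h + f k"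
    and "x \<in> qlie_ideal H"
  shows "glue_pairing S (frag_extend (leaf_extend f) x) z \<in> N"
  using assms(2)
proof (induction arbitrary: z)
  case (linear h k)
  then show ?case by (simp add: frag_extend_diff f zero_mem)
next
  case (antisym x y)
  show ?case by (simp add: frag_extend_add frag_extend_leaf_extend_bracket glue_pairing_antisym)
next
  case (jacobi x y z)
  show ?case by (simp add: frag_extend_add frag_extend_leaf_extend_bracket glue_pairing_jacobi)
next
  case zero
  show ?case by (simp add: zero_mem)
next
  case (diff x y)
  then show ?case by (simp add: frag_extend_diff glue_pairing_diff_left diff_mem)
next
  case (left x y)
  then show ?case by (simp add: frag_extend_leaf_extend_bracket glue_pairing_rotate)
next
  case (right x y)
  then show ?case by (simp add: frag_extend_leaf_extend_bracket glue_pairing_invariant)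
qed

end

text \<open>
  Moving the distinguished edge through the tree to a univalent vertex is exactly what
  \<^const>\<open>rootings_in\<close> records, so closing a root with its old label undoes the rooting. This is
  why contraction after \<open>\<eta>'\<close> returns multiples of the tree itself.
\<close>

lemma glue_rootings_in: "p \<in># rootings_in s t \<Longrightarrow> glue (Leaf (fst p)) (snd p) = glue s t"
proof (induction s arbitrary: t)
  case (Node a b)
  have "glue b (Node t a) = glue a (Node b t)" by (metis glue_across glue_commute)
  with Node show ?case by (auto simp: glue_across)
qed simp

lemma glue_rootings: "p \<in># rootings T \<Longrightarrow> glue (Leaf (fst p)) (snd p) = T"
proof -
  assume p: "p \<in># rootings T"
  obtain s t where T: "T = glue s t" by (rule utree_cases)
  from p show ?thesis unfolding T rootings_glue
    by (auto dest!: glue_rootings_in simp: glue_commute)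
qed

lemma image_fst_rootings_in: "image_mset fst (rootings_in s t) = rtree_labels s"
  by (induction s arbitrary: t) auto

lemma image_fst_rootings: "image_mset fst (rootings T) = labels T"
proof -
  obtain s t where T: "T = glue s t" by (rule utree_cases)
  show ?thesis by (simp add: T rootings_glue labels_glue image_fst_rootings_in)
qed


section \<open>Coordinates\<close>

locale based_group =
  fixes H :: "('h, 'm) monoid_scheme" and \<alpha> :: "nat \<Rightarrow> 'h" and d :: nat
  assumes H: "comm_group H" and basis: "free_basis H \<alpha> d"
begin

definition coord :: "'h \<Rightarrow> nat \<Rightarrow> int" where
  "coord h = (THE c. c \<in> {1..d} \<rightarrow>\<^sub>E UNIV \<and> h = (\<Otimes>\<^bsub>H\<^esub>i\<in>{1..d}. \<alpha> i [^]\<^bsub>H\<^esub> c i))"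

lemma basis_carrier: "i \<in> {1..d} \<Longrightarrow> \<alpha> i \<in> carrier H"
  using basis by (auto simp: free_basis_def)

lemma unique_expansion:
  "h \<in> carrier H \<Longrightarrow>
    \<exists>!c. c \<in> {1..d} \<rightarrow>\<^sub>E UNIV \<and> h = (\<Otimes>\<^bsub>H\<^esub>i\<in>{1..d}. \<alpha> i [^]\<^bsub>H\<^esub> (c i :: int))"
  using basis unfolding free_basis_def by (elim conjE bspec)

lemma coord_expansion:
  assumes "h \<in> carrier H"
  shows "coord h \<in> {1..d} \<rightarrow>\<^sub>E UNIV \<and> h = (\<Otimes>\<^bsub>H\<^esub>i\<in>{1..d}. \<alpha> i [^]\<^bsub>H\<^esub> coord h i)"
  unfolding coord_def by (rule theI'[OF unique_expansion[OF assms]])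

lemma coord_eqI:
  assumes "h \<in> carrier H" and "h = (\<Otimes>\<^bsub>H\<^esub>i\<in>{1..d}. \<alpha> i [^]\<^bsub>H\<^esub> (c i :: int))" and "i \<in> {1..d}"
  shows "coord h i = c i"
proof -
  interpret comm_group H by (rule H)
  have "(\<Otimes>\<^bsub>H\<^esub>i\<in>{1..d}. \<alpha> i [^]\<^bsub>H\<^esub> c i) = (\<Otimes>\<^bsub>H\<^esub>i\<in>{1..d}. \<alpha> i [^]\<^bsub>H\<^esub> restrict c {1..d} i)"
    by (rule finprod_cong') (auto simp: basis_carrier)
  with assms have "restrict c {1..d} \<in> {1..d} \<rightarrow>\<^sub>E UNIV \<and>
      h = (\<Otimes>\<^bsub>H\<^esub>i\<in>{1..d}. \<alpha> i [^]\<^bsub>H\<^esub> restrict c {1..d} i)" by auto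
  then have "coord h = restrict c {1..d}"
    unfolding coord_def by (rule the1_equality[OF unique_expansion[OF assms(1)]])
  then show ?thesis using assms(3) by simp
qed

lemma coord_mult:
  assumes "h \<in> carrier H" "k \<in> carrier H" "i \<in> {1..d}"
  shows "coord (h \<otimes>\<^bsub>H\<^esub> k) i = coord h i + coord k i"
proof (rule coord_eqI[OF _ _ assms(3)])
  interpret comm_group H by (rule H)
  show "h \<otimes>\<^bsub>H\<^esub> k \<in> carrier H" using assms by simp
  have "h \<otimes>\<^bsub>H\<^esub> k = (\<Otimes>\<^bsub>H\<^esub>i\<in>{1..d}. \<alpha> i [^]\<^bsub>H\<^esub> coord h i) \<otimes>\<^bsub>H\<^esub> (\<Otimes>\<^bsub>H\<^esub>i\<in>{1..d}. \<alpha> i [^]\<^bsub>H\<^esub> coord k i)"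
    by (rule arg_cong2[where f = "monoid.mult H",
          OF conjunct2[OF coord_expansion[OF assms(1)]] conjunct2[OF coord_expansion[OF assms(2)]]])
  also have "\<dots> = (\<Otimes>\<^bsub>H\<^esub>i\<in>{1..d}. \<alpha> i [^]\<^bsub>H\<^esub> coord h i \<otimes>\<^bsub>H\<^esub> \<alpha> i [^]\<^bsub>H\<^esub> coord k i)"
    by (rule finprod_multf[symmetric]) (auto simp: basis_carrier)
  also have "\<dots> = (\<Otimes>\<^bsub>H\<^esub>i\<in>{1..d}. \<alpha> i [^]\<^bsub>H\<^esub> (coord h i + coord k i))"
    by (rule finprod_cong') (auto simp: basis_carrier int_pow_mult)
  finally show "h \<otimes>\<^bsub>H\<^esub> k = (\<Otimes>\<^bsub>H\<^esub>i\<in>{1..d}. \<alpha> i [^]\<^bsub>H\<^esub> (coord h i + coord k i))" .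
qed

lemma coord_basis:
  assumes "i \<in> {1..d}" "j \<in> {1..d}"
  shows "coord (\<alpha> j) i = (if i = j then 1 else 0)"
proof (rule coord_eqI[OF basis_carrier[OF assms(2)] _ assms(1)])
  interpret comm_group H by (rule H)
  have "(\<Otimes>\<^bsub>H\<^esub>i\<in>{1..d}. \<alpha> i [^]\<^bsub>H\<^esub> (if i = j then 1 else 0 :: int)) =
      (\<Otimes>\<^bsub>H\<^esub>i\<in>{1..d}. if j = i then \<alpha> i else \<one>\<^bsub>H\<^esub>)"
    by (rule finprod_cong') (auto simp: basis_carrier)
  also have "\<dots> = \<alpha> j" using assms basis_carrier by (subst finprod_singleton) auto
  finally show "\<alpha> j = (\<Otimes>\<^bsub>H\<^esub>i\<in>{1..d}. \<alpha> i [^]\<^bsub>H\<^esub> (if i = j then 1 else 0 :: int))" by simp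
qed

definition leaf_expansion :: "'h \<Rightarrow> ('h rtree \<Rightarrow>\<^sub>0 int)" where
  "leaf_expansion h = (\<Sum>i=1..d. frag_cmul (coord h i) (frag_of (Leaf (\<alpha> i))))"

abbreviation expand :: "('h rtree \<Rightarrow>\<^sub>0 int) \<Rightarrow> ('h rtree \<Rightarrow>\<^sub>0 int)" where
  "expand \<equiv> frag_extend (leaf_extend leaf_expansion)"

lemma leaf_expansion_mult:
  "h \<in> carrier H \<Longrightarrow> k \<in> carrier H \<Longrightarrow>
    leaf_expansion (h \<otimes>\<^bsub>H\<^esub> k) = leaf_expansion h + leaf_expansion k"
  by (simp add: leaf_expansion_def coord_mult frag_cmul_distrib sum.distrib)

lemma leaf_expansion_basis:
  assumes "h \<in> \<alpha> ` {1..d}"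
  shows "leaf_expansion h = frag_of (Leaf h)"
proof -
  obtain j where j: "j \<in> {1..d}" "h = \<alpha> j" using assms by blast
  have "leaf_expansion h = (\<Sum>i=1..d. if i = j then frag_of (Leaf (\<alpha> i)) else 0)"
    unfolding leaf_expansion_def j(2) by (rule sum.cong) (use j in \<open>auto simp: coord_basis\<close>)
  then show ?thesis using j by simp
qed

lemma expand_of:
  "set_mset (rtree_labels t) \<subseteq> \<alpha> ` {1..d} \<Longrightarrow> expand (frag_of t) = frag_of t"
  by (auto intro!: leaf_extend_of leaf_expansion_basis)

end

section \<open>Contraction with a basis element\<close>

locale signature = based_group +
  fixes \<omega> :: "nat \<Rightarrow> nat" and i :: nat
  assumes i: "i \<in> {1..d}"
begin

abbreviation S :: "'a utree set" where "S \<equiv> sig_trees \<alpha> d \<omega>"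

abbreviation N :: "('a utree \<Rightarrow>\<^sub>0 int) set" where
  "N \<equiv> generate (free_Abelian_group S) (sig_rels \<alpha> d \<omega>)"

abbreviation A :: "('a utree \<Rightarrow>\<^sub>0 int) set monoid" where "A \<equiv> sig_tree_group \<alpha> d \<omega>"

abbreviation proj :: "('a utree \<Rightarrow>\<^sub>0 int) \<Rightarrow> ('a utree \<Rightarrow>\<^sub>0 int) set" where
  "proj x \<equiv> N #>\<^bsub>free_Abelian_group S\<^esub> x"

sublocale A: comm_group A by (rule sig_tree_group_comm_group)

lemma proj_hom: "proj \<in> hom (free_Abelian_group S) A"
  unfolding sig_tree_group_def by (rule presented_proj_hom[OF sig_rels_carrier])

lemma proj_0: "proj 0 = \<one>\<^bsub>A\<^esub>"
  using hom_one[OF proj_hom] A.group_axioms by simp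

lemma proj_add:
  "Poly_Mapping.keys x \<subseteq> S \<Longrightarrow> Poly_Mapping.keys y \<subseteq> S \<Longrightarrow> proj (x + y) = proj x \<otimes>\<^bsub>A\<^esub> proj y"
  using hom_mult[OF proj_hom, of x y] by simp

sublocale tree_relations S N
proof
  interpret N: subgroup N "free_Abelian_group S"
    by (rule presented_subgroup(1)[OF sig_rels_carrier])
  show "0 \<in> N" using N.one_closed by simp
  show "x - y \<in> N" if "x \<in> N" "y \<in> N" for x y
    using N.m_closed[OF that(1) N.m_inv_closed[OF that(2)]] N.mem_carrier[OF that(2)] by simp
  show "as_rels S \<subseteq> N" "ihx_rels S \<subseteq> N"
    by (auto simp: sig_rels_def intro: generate.incl)
  show "glue (Node b a) c \<in> S" if "glue (Node a b) c \<in> S" for a b c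
    using that by (simp add: sig_trees_def labels_glue add_ac)
  show "ihx_tree B C A D \<in> S" if "ihx_tree A B C D \<in> S" for A B C D
    using that by (simp add: sig_trees_def ihx_tree_def labels_glue add_ac)
qed

text \<open>The bilinear map behind \<open>c\<^sub>i\<close>, on representatives in the free nonassociative ring.\<close>

definition close_root :: "'a \<Rightarrow> ('a rtree \<Rightarrow>\<^sub>0 int) \<Rightarrow> ('a utree \<Rightarrow>\<^sub>0 int)" where
  "close_root h x = frag_cmul (coord h i) (glue_pairing S (frag_of (Leaf (\<alpha> i))) (expand x))"

lemma close_root_keys: "Poly_Mapping.keys (close_root h x) \<subseteq> S"
  using glue_pairing_keys keys_cmul unfolding close_root_def by (rule order_trans[rotated])

lemma close_root_add: "close_root h (x + y) = close_root h x + close_root h y"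
  by (simp add: close_root_def frag_extend_add glue_pairing_add_right frag_cmul_distrib2)

lemma close_root_mult:
  "h \<in> carrier H \<Longrightarrow> k \<in> carrier H \<Longrightarrow> close_root (h \<otimes>\<^bsub>H\<^esub> k) x = close_root h x + close_root k x"
  by (simp add: close_root_def coord_mult[OF _ _ i] frag_cmul_distrib)

lemma proj_close_root_ideal:
  assumes "x \<in> qlie_ideal H"
  shows "proj (close_root h x) = \<one>\<^bsub>A\<^esub>"
proof -
  let ?w = "glue_pairing S (frag_of (Leaf (\<alpha> i))) (expand x)"
  note sub = presented_subgroup(1)[OF sig_rels_carrier, of \<alpha> d \<omega>]
  have "?w \<in> N"
    using qlie_ideal_radical[OF leaf_expansion_mult assms] by (subst glue_pairing_commute) simp
  then have "?w [^]\<^bsub>free_Abelian_group S\<^esub> coord h i \<in> N"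
    by (rule group.subgroup_int_pow_closed[OF group_free_Abelian_group sub])
  then have "close_root h x \<in> N" using glue_pairing_keys[of S] by (simp add: close_root_def)
  then have "proj (close_root h x) = N"
    by (intro group.coset_join2[OF group_free_Abelian_group _ sub]) (simp add: close_root_keys)
  then show ?thesis by (simp add: sig_tree_group_def presented_group_def one_FactGroup)
qed

text \<open>
  The descent to the quotient. The image under \<^const>\<open>the_elem\<close> is a singleton since
  representatives differ by the ideal, which lies in the radical of the pairing
  (\<open>proj_close_root_ideal\<close>).
\<close>

definition contract :: "'a \<times> ('a rtree \<Rightarrow>\<^sub>0 int) set \<Rightarrow> ('a utree \<Rightarrow>\<^sub>0 int) set" where
  "contract p = the_elem ((\<lambda>x. proj (close_root (fst p) x)) ` snd p)"

lemma contract_class: "contract (h, qlie_class H x) = proj (close_root h x)"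
proof -
  have "proj (close_root h y) = proj (close_root h x)" if "y \<in> qlie_class H x" for y
  proof -
    have "close_root h y = close_root h (y - x) + close_root h x"
      by (simp flip: close_root_add)
    then show ?thesis
      using that hom_in_carrier[OF proj_hom, of "close_root h x"]
      by (simp add: proj_add close_root_keys proj_close_root_ideal mem_qlie_class)
  qed
  moreover have "x \<in> qlie_class H x" by (simp add: mem_qlie_class qlie_ideal.zero)
  ultimately have "(\<lambda>x. proj (close_root h x)) ` qlie_class H x = {proj (close_root h x)}" by blast
  then show ?thesis by (simp add: contract_def)
qed

definition contraction ::
    "('a \<times> ('a rtree \<Rightarrow>\<^sub>0 int) set \<Rightarrow>\<^sub>0 int) set \<Rightarrow> ('a utree \<Rightarrow>\<^sub>0 int) set" where
  "contraction = presented_map A contract"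

lemma free_qlie_degree_cases:
  assumes "U \<in> carrier (free_qlie_degree H m)"
  obtains x where "Poly_Mapping.keys x \<subseteq> rtrees H" "U = qlie_class H x"
proof -
  interpret comm_group "free_qlie H" by (rule free_qlie_comm_group[OF H])
  have "U \<in> carrier (free_qlie H)"
    using assms carrier_subgroup_generated_subset unfolding free_qlie_degree_def by blast
  then show ?thesis using that by (rule free_qlie_cases)
qed

lemma contract_carrier: "contract \<in> carrier H \<times> carrier (free_qlie_degree H m) \<rightarrow> carrier A"
proof (clarify)
  fix h U assume "U \<in> carrier (free_qlie_degree H m)"
  then show "contract (h, U) \<in> carrier A"
    by (rule free_qlie_degree_cases)
      (use hom_in_carrier[OF proj_hom] close_root_keys in \<open>auto simp: contract_class\<close>)
qed

lemma contract_tensor_rels: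
  assumes "r \<in> tensor_rels H (free_qlie_degree H m)"
  shows "free_map A contract r = \<one>\<^bsub>A\<^esub>"
proof -
  let ?L = "free_qlie_degree H m"
  interpret H: comm_group H by (rule H)
  interpret L: comm_group ?L by (rule free_qlie_degree_comm_group[OF H])
  \<comment> \<open>Both kinds of relation say that one generator is the sum of two others.\<close>
  have split: "free_map A contract (frag_of a - frag_of b - frag_of c) = \<one>\<^bsub>A\<^esub>"
    if abc: "a \<in> carrier H \<times> carrier ?L" "b \<in> carrier H \<times> carrier ?L" "c \<in> carrier H \<times> carrier ?L"
      and eq: "contract a = contract b \<otimes>\<^bsub>A\<^esub> contract c" for a b c
  proof -
    have k: "Poly_Mapping.keys (frag_of a - frag_of b) \<subseteq> carrier H \<times> carrier ?L"
      using abc by (auto dest!: subsetD[OF keys_diff])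
    have car: "contract a \<in> carrier A" "contract b \<in> carrier A" "contract c \<in> carrier A"
      using funcset_mem[OF contract_carrier] abc by blast+
    have "free_map A contract (frag_of a - frag_of b - frag_of c) =
        contract a \<otimes>\<^bsub>A\<^esub> inv\<^bsub>A\<^esub> contract b \<otimes>\<^bsub>A\<^esub> inv\<^bsub>A\<^esub> contract c"
      using k abc car
      by (simp add: free_map_diff[OF A.comm_group_axioms contract_carrier[of m]]
          free_map_of[OF A.comm_group_axioms])
    also have "\<dots> = \<one>\<^bsub>A\<^esub>"
      using car by (simp add: eq A.m_assoc A.m_comm[of "contract b"] A.inv_solve_right')
    finally show ?thesis .
  qed
  from assms consider
      (l) g g' U where "r = frag_of (g \<otimes>\<^bsub>H\<^esub> g', U) - frag_of (g, U) - frag_of (g', U)"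
        "g \<in> carrier H" "g' \<in> carrier H" "U \<in> carrier ?L"
    | (r) g U V where "r = frag_of (g, U \<otimes>\<^bsub>?L\<^esub> V) - frag_of (g, U) - frag_of (g, V)"
        "g \<in> carrier H" "U \<in> carrier ?L" "V \<in> carrier ?L"
    unfolding tensor_rels_def by blast
  then show ?thesis
  proof cases
    case l
    obtain x where x: "U = qlie_class H x" using l(4) by (rule free_qlie_degree_cases)
    show ?thesis unfolding l(1)
      by (rule split) (use l in \<open>auto simp: x contract_class close_root_mult proj_add close_root_keys\<close>)
  next
    case r
    obtain x where x: "Poly_Mapping.keys x \<subseteq> rtrees H" "U = qlie_class H x"
      using r(3) by (rule free_qlie_degree_cases)
    obtain y where y: "Poly_Mapping.keys y \<subseteq> rtrees H" "V = qlie_class H y"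
      using r(4) by (rule free_qlie_degree_cases)
    have UV: "U \<otimes>\<^bsub>?L\<^esub> V = qlie_class H (x + y)"
      using free_qlie_mult_class[OF H x(1) y(1)] by (simp add: free_qlie_degree_def x(2) y(2))
    have "contract (g, U \<otimes>\<^bsub>?L\<^esub> V) = contract (g, U) \<otimes>\<^bsub>A\<^esub> contract (g, V)"
      unfolding UV unfolding x(2) y(2) by (simp add: contract_class close_root_add proj_add close_root_keys)
    with r show ?thesis unfolding r(1) by (intro split) auto
  qed
qed

lemma contraction_hom: "contraction \<in> hom (tensor_group H (free_qlie_degree H m)) A"
  unfolding contraction_def tensor_group_def
  by (rule presented_map_hom[OF A.comm_group_axioms contract_carrier tensor_rels_carrier
        contract_tensor_rels]) (simp_all add: H free_qlie_degree_comm_group)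

lemma contraction_pure_tensor:
  assumes "h \<in> carrier H" "U \<in> carrier (free_qlie_degree H m)"
  shows "contraction (pure_tensor H (free_qlie_degree H m) h U) = contract (h, U)"
  unfolding contraction_def pure_tensor_def
  by (rule presented_map_class[OF A.comm_group_axioms contract_carrier tensor_rels_carrier
        contract_tensor_rels]) (use assms in \<open>simp_all add: H free_qlie_degree_comm_group\<close>)

lemma contract_rooting:
  assumes T: "T \<in> S" and p: "p \<in># rootings T"
  shows "contract (fst p, tree_bracket H (snd p)) = (if fst p = \<alpha> i then proj (frag_of T) else \<one>\<^bsub>A\<^esub>)"
proof -
  have glue: "glue (Leaf (fst p)) (snd p) = T" using p by (rule glue_rootings)
  then have "labels T = {#fst p#} + rtree_labels (snd p)" by (auto simp: labels_glue)
  with T have lab: "fst p \<in> \<alpha> ` {1..d}" "set_mset (rtree_labels (snd p)) \<subseteq> \<alpha> ` {1..d}"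
    by (auto simp: sig_trees_def)
  then have "snd p \<in> rtrees H" using basis_carrier by (auto simp: rtrees_def)
  then have "contract (fst p, tree_bracket H (snd p)) = proj (close_root (fst p) (frag_of (snd p)))"
    by (simp add: tree_bracket_class[OF H] contract_class)
  moreover obtain j where j: "j \<in> {1..d}" "fst p = \<alpha> j" using lab(1) by blast
  moreover have "\<alpha> j = \<alpha> i \<longleftrightarrow> i = j"
    using free_basis_inj[OF H basis] i j(1) by (auto dest: inj_onD)
  ultimately show ?thesis
    using expand_of[OF lab(2)] T glue proj_0 by (auto simp: close_root_def coord_basis[OF i])
qed

text \<open>
  Each univalent vertex of \<open>T\<close> with label \<open>\<alpha> i\<close> contributes one copy of \<open>T\<close> and each other one
  vanishes, because the \<open>i\<close>-th coordinate of its label is zero; the signature counts the former.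
\<close>

lemma contraction_eta_tree:
  assumes T: "T \<in> S" and Tn: "T \<in> trees H n"
  shows "contraction (eta_tree H n T) = proj (frag_of T) [^]\<^bsub>A\<^esub> \<omega> i"
proof -
  let ?L = "free_qlie_degree H (n + 1)"
  let ?P = "tensor_group H ?L"
  have L: "comm_group ?L" by (rule free_qlie_degree_comm_group[OF H])
  interpret P: comm_group ?P by (rule tensor_group_comm_group[OF H L])
  interpret c: group_hom ?P A contraction
    by unfold_locales (rule contraction_hom)
  let ?t = "\<lambda>p. pure_tensor H ?L (fst p) (tree_bracket H (snd p))"
  let ?M = "rootings T"
  have pL: "fst p \<in> carrier H" "tree_bracket H (snd p) \<in> carrier ?L" if "p \<in># ?M" for p
  proof -
    have "glue (Leaf (fst p)) (snd p) = T" using that by (rule glue_rootings)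
    with Tn have "fst p \<in> carrier H" "snd p \<in> rtrees_of_degree H (n + 1)"
      by (auto simp: trees_def labels_glue trivalent_glue rtrees_of_degree_def rtrees_def
          size_rtree_labels)
    moreover from this have "snd p \<in> rtrees H" using rtrees_of_degree_subset by blast
    ultimately show "fst p \<in> carrier H" "tree_bracket H (snd p) \<in> carrier ?L"
      using qlie_class_degree[OF H, of "frag_of (snd p)"] by (simp_all add: tree_bracket_class[OF H])
  qed
  then have pc: "?t p \<in> carrier ?P" if "p \<in># ?M" for p
    using that by (intro pure_tensor_carrier[OF H L]) auto
  let ?g = "\<lambda>p. if fst p = \<alpha> i then proj (frag_of T) else \<one>\<^bsub>A\<^esub>"
  have g: "contraction (?t p) = ?g p" if "p \<in># ?M" for p
    using that by (simp only: contraction_pure_tensor[OF pL] contract_rooting[OF T])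
  have gc: "?g p \<in> carrier A" for p
    using T hom_in_carrier[OF proj_hom, of "frag_of T"] by simp
  have "contraction (eta_tree H n T) =
      (\<Otimes>\<^bsub>A\<^esub>p\<in>set_mset ?M. contraction (?t p [^]\<^bsub>?P\<^esub> count ?M p))"
    unfolding eta_tree_def
    by (rule hom_finprod[OF P.comm_group_axioms A.comm_group_axioms contraction_hom])
      (use pc in \<open>blast intro: P.nat_pow_closed finite_set_mset\<close>)+
  also have "\<dots> = (\<Otimes>\<^bsub>A\<^esub>p\<in>set_mset ?M. ?g p [^]\<^bsub>A\<^esub> count ?M p)"
    by (intro A.finprod_cong' refl) (use gc in \<open>auto simp only: c.hom_nat_pow[OF pc] g
        intro!: A.nat_pow_closed\<close>)
  also have "\<dots> = proj (frag_of T) [^]\<^bsub>A\<^esub> (\<Sum>p\<in>{p \<in> set_mset ?M. fst p = \<alpha> i}. count ?M p)"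
    using T by (intro A.finprod_pow_indicator hom_in_carrier[OF proj_hom]) simp_all
  also have "(\<Sum>p\<in>{p \<in> set_mset ?M. fst p = \<alpha> i}. count ?M p) = count (image_mset fst ?M) (\<alpha> i)"
    by (simp add: count_image_mset vimage_def Int_def conj_commute)
  also have "\<dots> = \<omega> i" using T i by (simp add: image_fst_rootings sig_trees_def)
  finally show ?thesis .
qed

lemma contraction_eta:
  assumes n: "(\<Sum>i=1..d. \<omega> i) = n + 2" and X: "X \<in> carrier A"
  shows "contraction (eta H n (sig_inclusion H n X)) = X [^]\<^bsub>A\<^esub> \<omega> i"
proof -
  note sig = H basis n
  let ?f = "contraction \<circ> (eta H n \<circ> sig_inclusion H n)"
  have f: "?f \<in> hom (presented_group S (sig_rels \<alpha> d \<omega>)) A"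
    using hom_compose[OF hom_compose[OF sig_inclusion_hom[OF sig] eta_hom[OF H]] contraction_hom]
    by (simp add: sig_tree_group_def)
  have g: "(\<lambda>X. X [^]\<^bsub>A\<^esub> \<omega> i) \<in> hom (presented_group S (sig_rels \<alpha> d \<omega>)) A"
    using A.nat_pow_distrib by (auto intro!: homI simp flip: sig_tree_group_def)
  have "?f X = X [^]\<^bsub>A\<^esub> \<omega> i"
  proof (rule hom_eq_on_presented_classes[OF sig_rels_carrier A.group_axioms f g])
    fix T assume T: "T \<in> S"
    then have "T \<in> trees H n" using sig_trees_subset[OF sig] by blast
    with T show "?f (presented_class S (sig_rels \<alpha> d \<omega>) T) =
        presented_class S (sig_rels \<alpha> d \<omega>) T [^]\<^bsub>A\<^esub> \<omega> i"
      by (simp add: sig_inclusion_class[OF sig] eta_class[OF H] contraction_eta_tree)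
        (simp add: presented_class_def)
  qed (use X in \<open>simp add: sig_tree_group_def\<close>)
  then show ?thesis by simp
qed

end

section \<open>The kernel of \<open>\<eta>'\<close>\<close>

theorem theorem4p1:
  fixes H :: "('h, 'm) monoid_scheme" and \<alpha> :: "nat \<Rightarrow> 'h" and \<omega> :: "nat \<Rightarrow> nat"
    and d n :: nat
  assumes "comm_group H" and "free_basis H \<alpha> d"
    and "n \<ge> 1" and "(\<Sum>i=1..d. \<omega> i) = n + 2"
  shows "\<forall>x \<in> kernel (sig_tree_group \<alpha> d \<omega>) (tensor_group H (free_qlie_degree H (n + 1)))
                 (eta H n \<circ> sig_inclusion H n).
           x [^]\<^bsub>sig_tree_group \<alpha> d \<omega>\<^esub> Gcd (\<omega> ` {1..d}) = \<one>\<^bsub>sig_tree_group \<alpha> d \<omega>\<^esub>"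
proof
  let ?A = "sig_tree_group \<alpha> d \<omega>" and ?P = "tensor_group H (free_qlie_degree H (n + 1))"
  fix x assume "x \<in> kernel ?A ?P (eta H n \<circ> sig_inclusion H n)"
  then have x: "x \<in> carrier ?A" and ker: "eta H n (sig_inclusion H n x) = \<one>\<^bsub>?P\<^esub>"
    by (auto simp: kernel_def)
  interpret A: comm_group ?A by (rule sig_tree_group_comm_group)
  interpret P: comm_group ?P
    by (intro tensor_group_comm_group free_qlie_degree_comm_group assms(1))
  have "x [^]\<^bsub>?A\<^esub> \<omega> i = \<one>\<^bsub>?A\<^esub>" if "i \<in> {1..d}" for i
  proof -
    interpret signature H \<alpha> d \<omega> i
      by (intro signature.intro based_group.intro signature_axioms.intro assms(1,2) that)
    have "contraction \<one>\<^bsub>?P\<^esub> = \<one>\<^bsub>?A\<^esub>"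
      using hom_one[OF contraction_hom P.group_axioms A.group_axioms] .
    with contraction_eta[OF assms(4) x] ker show ?thesis by simp
  qed
  with x show "x [^]\<^bsub>?A\<^esub> Gcd (\<omega> ` {1..d}) = \<one>\<^bsub>?A\<^esub>"
    by (intro A.pow_Gcd_eq_one) auto
qed

end
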